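(* Let $d\ge1$ and let $\mathcal S\subseteq\mathbb M^d_{\mathrm{sa}}$ be a bounded matrix convex set. Then for every $\varepsilon>0$ there is a $\delta>0$ such that for all $n\in\mathbb N$ and all $A\in(M_n)^d_{\mathrm{sa}}$: if $d(A,\mathcal S)>\varepsilon$, then there exists $p\in M_n(\mathbb C_1\langle z\rangle)$ with $\|p\|\le1$ such that for all $X\in\mathcal S$, $$\|p(A)\|>\|p(X)\|+\delta.$$ Furthermore, $\delta$ can be chosen to depend only on $\varepsilon$, $d$, and a positive number $R$ such that $\mathcal S\subseteq R\,\mathfrak B_d$ (in particular, $\delta$ is independent of the level $n$ and of the matrix convex set $\mathcal S$).
   Context: $M_n=M_n(\mathbb C)$; $(M_n)^d_{\mathrm{sa}}$ is the set of $d$-tuples of selfadjoint $n\times n$ matrices; $\mathbb M^d_{\mathrm{sa}}=\bigcup_{n\ge1}(M_n)^d_{\mathrm{sa}}$ (disjoint union). For $\mathcal S\subseteq\mathbb M^d_{\mathrm{sa}}$ the $n$th level is $\mathcal S_n=\mathcal S\cap(M_n)^d_{\mathrm{sa}}$. $\mathcal S$ is matrix convex if it is closed under direct sums and under unital completely positive (UCP) maps: if $X\in\mathcal S_n$ and $\phi\colon M_n\to M_k$ is UCP, then $(\phi(X_1),\ldots,\phi(X_d))\in\mathcal S_k$. For a tuple $X$ of operators, $\|X\|:=\|\sum_iX_iX_i^*\|^{1/2}$. $\mathcal S$ is bounded if there is $R>0$ with $\|X\|\le R$ for all $X\in\mathcal S$. For $A\in(M_n)^d_{\mathrm{sa}}$,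 $d(A,\mathcal S):=d(A,\mathcal S_n)=\inf_{X\in\mathcal S_n}\|A-X\|$. $\mathfrak B_d=\{X\in\mathbb M^d_{\mathrm{sa}}:\sum_iX_i^2\le I\}$. $M_n(\mathbb C_1\langle z\rangle)$ is the space of polynomials $p=a_0+\sum_{i=1}^d a_iz_i$ of degree at most $1$ in noncommuting variables $z_1,\ldots,z_d$ with coefficients $a_i\in M_n$; evaluation is $p(X)=a_0\otimes I+\sum_ia_i\otimes X_i$. It carries the norm $\|p\|=\sup\{\|p(X)\|:X\in\mathbb M^d_{\mathrm{sa}},\ \|X\|\le1\}$. *)

theory Defs
  imports "Jordan_Normal_Form.Schur_Decomposition" "HOL-Library.Extended_Real"
begin

definition vec_l2norm :: "complex vec \<Rightarrow> real" where
  "vec_l2norm v = sqrt (\<Sum>i<dim_vec v. (cmod (v $ i))\<^sup>2)"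

definition op_norm :: "complex mat \<Rightarrow> real" where
  "op_norm A = Sup {vec_l2norm (A *\<^sub>v v) | v. v \<in> carrier_vec (dim_col A) \<and> vec_l2norm v \<le> 1}"

text \<open>The order on \<^typ>\<open>complex\<close> is the one of HOL-Library.Complex_Order, so
  \<open>0 \<le> z\<close> says that z is real and nonnegative; over the complex numbers this makes A selfadjoint.\<close>

definition psd :: "nat \<Rightarrow> complex mat \<Rightarrow> bool" where
  "psd n A \<longleftrightarrow> A \<in> carrier_mat n n \<and> (\<forall>v \<in> carrier_vec n. 0 \<le> (A *\<^sub>v v) \<bullet>c v)"

definition kron :: "complex mat \<Rightarrow> complex mat \<Rightarrow> complex mat" where
  "kron A B = mat (dim_row A * dim_row B) (dim_col A * dim_col B)
     (\<lambda>(i, j). A $$ (i div dim_row B, j div dim_col B) * B $$ (i mod dim_row B, j mod dim_col B))"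

definition mat_sum :: "nat \<Rightarrow> complex mat list \<Rightarrow> complex mat" where
  "mat_sum n As = foldr (+) As (0\<^sub>m n n)"

text \<open>A d-tuple of matrices is a list of length d.  A nonempty tuple determines its level, so for
  \<open>d \<ge> 1\<close> the sets \<open>sa_tuples d n\<close> are pairwise disjoint and their union over
  \<open>n \<ge> 1\<close> is the disjoint union of all levels.\<close>

definition tuple_level :: "complex mat list \<Rightarrow> nat" where
  "tuple_level X = dim_row (hd X)"

definition sa_tuples :: "nat \<Rightarrow> nat \<Rightarrow> complex mat list set" where
  "sa_tuples d n = {X. length X = d \<and> (\<forall>x \<in> set X. x \<in> carrier_mat n n \<and> mat_adjoint x = x)}"

definition all_sa_tuples :: "nat \<Rightarrow> complex mat list set" where
  "all_sa_tuples d = (\<Union>n \<in> {1..}. sa_tuples d n)"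

definition tuple_norm :: "complex mat list \<Rightarrow> real" where
  "tuple_norm X = sqrt (op_norm (mat_sum (tuple_level X) (map (\<lambda>x. x * mat_adjoint x) X)))"

definition tuple_direct_sum :: "complex mat list \<Rightarrow> complex mat list \<Rightarrow> complex mat list" where
  "tuple_direct_sum X Y = map2 (\<lambda>x y. four_block_mat x (0\<^sub>m (dim_row x) (dim_col y))
     (0\<^sub>m (dim_row y) (dim_col x)) y) X Y"

definition linear_map_mat :: "nat \<Rightarrow> nat \<Rightarrow> (complex mat \<Rightarrow> complex mat) \<Rightarrow> bool" where
  "linear_map_mat n k \<phi> \<longleftrightarrow>
     (\<forall>A \<in> carrier_mat n n. \<phi> A \<in> carrier_mat k k) \<and>
     (\<forall>A \<in> carrier_mat n n. \<forall>B \<in> carrier_mat n n. \<phi> (A + B) = \<phi> A + \<phi> B) \<and>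
     (\<forall>c. \<forall>A \<in> carrier_mat n n. \<phi> (c \<cdot>\<^sub>m A) = c \<cdot>\<^sub>m \<phi> A)"

text \<open>\<open>ampliation m n k \<phi>\<close> applies \<open>\<phi>\<close> to each of the m-by-m blocks of size n-by-n.\<close>

definition block_of :: "nat \<Rightarrow> complex mat \<Rightarrow> nat \<Rightarrow> nat \<Rightarrow> complex mat" where
  "block_of n P a b = mat n n (\<lambda>(i, j). P $$ (a * n + i, b * n + j))"

definition ampliation ::
  "nat \<Rightarrow> nat \<Rightarrow> nat \<Rightarrow> (complex mat \<Rightarrow> complex mat) \<Rightarrow> complex mat \<Rightarrow> complex mat" where
  "ampliation m n k \<phi> P = mat (m * k) (m * k)
     (\<lambda>(i, j). \<phi> (block_of n P (i div k) (j div k)) $$ (i mod k, j mod k))"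

definition completely_positive :: "nat \<Rightarrow> nat \<Rightarrow> (complex mat \<Rightarrow> complex mat) \<Rightarrow> bool" where
  "completely_positive n k \<phi> \<longleftrightarrow> linear_map_mat n k \<phi> \<and>
     (\<forall>m P. psd (m * n) P \<longrightarrow> psd (m * k) (ampliation m n k \<phi> P))"

definition ucp :: "nat \<Rightarrow> nat \<Rightarrow> (complex mat \<Rightarrow> complex mat) \<Rightarrow> bool" where
  "ucp n k \<phi> \<longleftrightarrow> completely_positive n k \<phi> \<and> \<phi> (1\<^sub>m n) = 1\<^sub>m k"

definition matrix_convex :: "nat \<Rightarrow> complex mat list set \<Rightarrow> bool" where
  "matrix_convex d S \<longleftrightarrow> S \<subseteq> all_sa_tuples d \<and>
     (\<forall>X \<in> S. \<forall>Y \<in> S. tuple_direct_sum X Y \<in> S) \<and>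
     (\<forall>n k \<phi> X. 1 \<le> n \<longrightarrow> 1 \<le> k \<longrightarrow> X \<in> S \<inter> sa_tuples d n \<longrightarrow> ucp n k \<phi> \<longrightarrow> map \<phi> X \<in> S)"

definition tuples_bounded :: "complex mat list set \<Rightarrow> bool" where
  "tuples_bounded S \<longleftrightarrow> (\<exists>R>0. \<forall>X \<in> S. tuple_norm X \<le> R)"

definition sa_ball :: "nat \<Rightarrow> complex mat list set" where
  "sa_ball d = {X \<in> all_sa_tuples d.
     psd (tuple_level X) (1\<^sub>m (tuple_level X) - mat_sum (tuple_level X) (map (\<lambda>x. x * x) X))}"

definition scale_tuples :: "real \<Rightarrow> complex mat list set \<Rightarrow> complex mat list set" where
  "scale_tuples R S = (\<lambda>X. map (\<lambda>x. complex_of_real R \<cdot>\<^sub>m x) X) ` S"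

text \<open>Extended-real valued, so that the distance to an empty level is \<open>\<infinity>\<close>.\<close>

definition tuple_dist :: "complex mat list \<Rightarrow> complex mat list set \<Rightarrow> ereal" where
  "tuple_dist A S = (INF X \<in> S \<inter> sa_tuples (length A) (tuple_level A).
     ereal (tuple_norm (map2 (-) A X)))"

text \<open>The pair \<open>(a\<^sub>0, [a\<^sub>1, \<dots>, a\<^sub>d])\<close> of coefficients stands for the polynomial
  \<open>a\<^sub>0 + \<Sum>i. a\<^sub>i z\<^sub>i\<close>.\<close>

type_synonym affine_poly = "complex mat \<times> complex mat list"

definition affine_polys :: "nat \<Rightarrow> nat \<Rightarrow> affine_poly set" where
  "affine_polys d n = {(a0, as). a0 \<in> carrier_mat n n \<and> length as = d \<and> set as \<subseteq> carrier_mat n n}"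

definition poly_eval :: "affine_poly \<Rightarrow> complex mat list \<Rightarrow> complex mat" where
  "poly_eval p X = kron (fst p) (1\<^sub>m (tuple_level X)) +
     mat_sum (dim_row (fst p) * tuple_level X) (map2 kron (snd p) X)"

definition poly_norm :: "affine_poly \<Rightarrow> ereal" where
  "poly_norm p = (SUP X \<in> {X \<in> all_sa_tuples (length (snd p)). tuple_norm X \<le> 1}.
     ereal (op_norm (poly_eval p X)))"

end

theory Submission
  imports Defs
begin

text \<open>
  Let \<open>R \<ge> 1\<close> bound the norms of the components of all elements of S.
  Fix A at level n and let C be the set of all tuples \<open>(V\<^sup>*V, V\<^sup>*X\<^sub>1V, \<dots>, V\<^sup>*X\<^sub>dV)\<close> with X in S of
  some level k and V a k-by-n matrix.  Direct sums make C a convex cone, and closure under UCP maps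
  says that the elements of C with first component 1 are exactly the elements of S at level n.
  If \<open>(1, A)\<close> were componentwise within \<open>2e\<close> of C, then A would be within a multiple
  \<open>(2 + 6R) e\<close> of S: shrink \<open>V\<^sup>*V\<close> slightly below 1 and fill the defect by a small
  element of C (\<open>compression_cone_near_gives_near_element\<close>).  Hence \<open>(1, A)\<close> is far
  from C, for an e proportional to \<open>\<epsilon>\<close>.

  The separating functional must be normalised in a way that does not see n.  This is achieved by
  separating in one more matrix variable: \<open>(1, A, e 1)\<close> is at positive distance from the convex
  cone of all \<open>(y, G)\<close> for which some g in C satisfies \<open>-G \<le> y\<^sub>j - g\<^sub>j \<le> G\<close> for all j.
  A functional \<open>(f\<^sub>0, \<dots>, f\<^sub>d, w)\<close> that is nonnegative on this cone and nonpositive at the point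
  consists of a functional f that is nonnegative on C together with a positive matrix w such that
  \<open>-w \<le> f\<^sub>j \<le> w\<close> and the value of f at \<open>(1, A)\<close> is at most \<open>-e tr w\<close>
  (\<open>separating_functional\<close>).  Thus w replaces a bound on the trace norm of f.

  Write \<open>w = TT\<^sup>*\<close> and \<open>b\<^sub>j = T\<^sup>-\<^sup>1 f\<^sub>j (T\<^sup>*)\<^sup>-\<^sup>1\<close>.  Then \<open>-1 \<le> b\<^sub>j \<le> 1\<close>, and
  the polynomial \<open>q = b\<^sub>0 + \<Sum>j. b\<^sub>j z\<^sub>j\<close> is positive semidefinite on S, because the quadratic form of
  \<open>b \<otimes> X\<close> at the vector with matrix V is the pairing of b with \<open>V\<^sup>*XV\<close>.  At A, the
  vector given by T shows that the form of q takes a value of at most \<open>-e\<close> times the squared length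
  (\<open>normalised_separating_functional\<close>).  With \<open>M = (d + 1) R\<close> one has
  \<open>0 \<le> q \<le> M\<close> on S, so \<open>M - q\<close> has norm at most M on S and at least \<open>M + e\<close> at A, while its norm
  on the unit ball is at most \<open>M + d + 1\<close>.  Dividing by \<open>M + d + 1\<close> gives the polynomial p
  (\<open>uniform_separation\<close>), with a gap that depends only on \<open>\<epsilon>\<close>, d and R.  The size n enters
  only in perturbations that may be chosen arbitrarily small after n is known.

  The computations treat an n-by-n matrix as a function of two indices, of which only the values
  below n matter, so that sizes which vary within one argument cost nothing.
\<close>

section \<open>Sesquilinear forms\<close>

text \<open>Only the values of \<open>X\<close>, \<open>u\<close> and \<open>v\<close> at indices below
  \<open>n\<close> enter; the form is conjugate-linear in the first vector.\<close>

definition sesq :: "nat \<Rightarrow> (nat \<Rightarrow> nat \<Rightarrow> complex) \<Rightarrow> (nat \<Rightarrow> complex) \<Rightarrow> (nat \<Rightarrow> complex) \<Rightarrow> complex" where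
  "sesq n X u v = (\<Sum>i<n. \<Sum>j<n. cnj (u i) * X i j * v j)"

definition qform :: "nat \<Rightarrow> (nat \<Rightarrow> nat \<Rightarrow> complex) \<Rightarrow> (nat \<Rightarrow> complex) \<Rightarrow> real" where
  "qform n X u = Re (sesq n X u u)"

definition sqnorm :: "nat \<Rightarrow> (nat \<Rightarrow> complex) \<Rightarrow> real" where
  "sqnorm n u = (\<Sum>i<n. (cmod (u i))\<^sup>2)"

definition herm :: "nat \<Rightarrow> (nat \<Rightarrow> nat \<Rightarrow> complex) \<Rightarrow> bool" where
  "herm n X \<longleftrightarrow> (\<forall>i<n. \<forall>j<n. X j i = cnj (X i j))"

definition pos_semidef :: "nat \<Rightarrow> (nat \<Rightarrow> nat \<Rightarrow> complex) \<Rightarrow> bool" where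
  "pos_semidef n X \<longleftrightarrow> herm n X \<and> (\<forall>u. 0 \<le> qform n X u)"

text \<open>The pairing uses neither a conjugate nor a transpose.  With this choice the quadratic form of
  a Kronecker product is a pairing on the nose; for selfadjoint arguments it is the trace of one matrix
  times the conjugate of the other.\<close>

definition pairing :: "nat \<Rightarrow> (nat \<Rightarrow> nat \<Rightarrow> complex) \<Rightarrow> (nat \<Rightarrow> nat \<Rightarrow> complex) \<Rightarrow> real" where
  "pairing n B Y = Re (\<Sum>a<n. \<Sum>c<n. B a c * Y a c)"

text \<open>This is the identity matrix, and its row \<open>a\<close> is the basis vector with number
  \<open>a\<close>.\<close>

definition unitf :: "nat \<Rightarrow> nat \<Rightarrow> complex" where
  "unitf i j = (if i = j then 1 else 0)"

lemma sesq_cong: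
  assumes "\<And>i j. i < n \<Longrightarrow> j < n \<Longrightarrow> X i j = Y i j" "\<And>i. i < n \<Longrightarrow> u i = u' i" "\<And>i. i < n \<Longrightarrow> v i = v' i"
  shows "sesq n X u v = sesq n Y u' v'"
  unfolding sesq_def using assms by (intro sum.cong refl) auto

lemma qform_cong:
  assumes "\<And>i j. i < n \<Longrightarrow> j < n \<Longrightarrow> X i j = Y i j" "\<And>i. i < n \<Longrightarrow> u i = v i"
  shows "qform n X u = qform n Y v"
  unfolding qform_def using sesq_cong[OF assms(1) assms(2) assms(2)] by simp

lemma herm_cong:
  assumes "\<And>i j. i < n \<Longrightarrow> j < n \<Longrightarrow> X i j = Y i j"
  shows "herm n X = herm n Y"
  unfolding herm_def using assms by metis

lemma pos_semidef_cong:
  assumes "\<And>i j. i < n \<Longrightarrow> j < n \<Longrightarrow> X i j = Y i j"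
  shows "pos_semidef n X = pos_semidef n Y"
  unfolding pos_semidef_def herm_def using assms qform_cong[OF assms refl] by auto

lemma sesq_add_mat: "sesq n (\<lambda>i j. X i j + Y i j) u v = sesq n X u v + sesq n Y u v"
  by (simp add: sesq_def algebra_simps sum.distrib)

lemma sesq_diff_mat: "sesq n (\<lambda>i j. X i j - Y i j) u v = sesq n X u v - sesq n Y u v"
  by (simp add: sesq_def algebra_simps sum_subtractf)

lemma sesq_scale_mat: "sesq n (\<lambda>i j. c * X i j) u v = c * sesq n X u v"
  by (simp add: sesq_def sum_distrib_left algebra_simps)

lemma sesq_sum_right: "sesq n X u (\<lambda>j. \<Sum>s\<in>I. f s * v s j) = (\<Sum>s\<in>I. f s * sesq n X u (v s))"
proof -
  have "sesq n X u (\<lambda>j. \<Sum>s\<in>I. f s * v s j) = (\<Sum>i<n. \<Sum>j<n. \<Sum>s\<in>I. f s * (cnj (u i) * X i j * v s j))"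
    unfolding sesq_def by (simp add: sum_distrib_left algebra_simps)
  also have "\<dots> = (\<Sum>i<n. \<Sum>s\<in>I. \<Sum>j<n. f s * (cnj (u i) * X i j * v s j))"
    by (intro sum.cong refl sum.swap)
  also have "\<dots> = (\<Sum>s\<in>I. \<Sum>i<n. \<Sum>j<n. f s * (cnj (u i) * X i j * v s j))"
    by (rule sum.swap)
  finally show ?thesis by (simp add: sesq_def sum_distrib_left)
qed

lemma sesq_sum_left: "sesq n X (\<lambda>j. \<Sum>s\<in>I. f s * u s j) v = (\<Sum>s\<in>I. cnj (f s) * sesq n X (u s) v)"
proof -
  have "sesq n X (\<lambda>j. \<Sum>s\<in>I. f s * u s j) v = (\<Sum>i<n. \<Sum>j<n. \<Sum>s\<in>I. cnj (f s) * (cnj (u s i) * X i j * v j))"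
    unfolding sesq_def by (simp add: sum_distrib_left sum_distrib_right algebra_simps)
  also have "\<dots> = (\<Sum>i<n. \<Sum>s\<in>I. \<Sum>j<n. cnj (f s) * (cnj (u s i) * X i j * v j))"
    by (intro sum.cong refl sum.swap)
  also have "\<dots> = (\<Sum>s\<in>I. \<Sum>i<n. \<Sum>j<n. cnj (f s) * (cnj (u s i) * X i j * v j))"
    by (rule sum.swap)
  finally show ?thesis by (simp add: sesq_def sum_distrib_left)
qed

lemma sesq_add_vec:
  "sesq n X (\<lambda>i. u i + v i) w = sesq n X u w + sesq n X v w"
  "sesq n X w (\<lambda>i. u i + v i) = sesq n X w u + sesq n X w v"
  by (simp_all add: sesq_def algebra_simps sum.distrib)

lemma sesq_diff_vec:
  "sesq n X (\<lambda>i. u i - v i) w = sesq n X u w - sesq n X v w"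
  "sesq n X w (\<lambda>i. u i - v i) = sesq n X w u - sesq n X w v"
  by (simp_all add: sesq_def algebra_simps sum_subtractf)

lemma sesq_scale_vec:
  "sesq n X (\<lambda>i. c * u i) w = cnj c * sesq n X u w"
  "sesq n X w (\<lambda>i. c * u i) = c * sesq n X w u"
  by (simp_all add: sesq_def algebra_simps sum_distrib_left)

lemma sesq_basis:
  assumes "a < n" "c < n"
  shows "sesq n X (unitf a) (unitf c) = X a c"
proof -
  have "sesq n X (unitf a) (unitf c) = (\<Sum>i<n. \<Sum>j<n. if j = c then cnj (unitf a i) * X i j else 0)"
    unfolding sesq_def unitf_def by (intro sum.cong refl) auto
  also have "\<dots> = (\<Sum>i<n. if i = a then X i c else 0)"
    using assms by (intro sum.cong refl) (auto simp: unitf_def)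
  finally show ?thesis using assms by simp
qed

lemma hermD: "herm n X \<Longrightarrow> i < n \<Longrightarrow> j < n \<Longrightarrow> X j i = cnj (X i j)"
  unfolding herm_def by blast

lemma sesq_herm:
  assumes "herm n X"
  shows "sesq n X v u = cnj (sesq n X u v)"
proof -
  have "sesq n X v u = (\<Sum>j<n. \<Sum>i<n. cnj (v i) * X i j * u j)"
    unfolding sesq_def by (rule sum.swap)
  also have "\<dots> = (\<Sum>j<n. \<Sum>i<n. cnj (cnj (u j) * X j i * v i))"
    by (intro sum.cong refl) (simp add: hermD[OF assms, symmetric])
  finally show ?thesis by (simp add: sesq_def)
qed

lemma sesq_herm_real:
  assumes "herm n X"
  shows "sesq n X u u = of_real (qform n X u)"
proof -
  have "Im (sesq n X u u) = - Im (sesq n X u u)"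
    using arg_cong[OF sesq_herm[OF assms, of u u], of Im] by simp
  then show ?thesis unfolding qform_def by (simp add: complex_eq_iff)
qed

lemma sesq_unit: "sesq n unitf u v = (\<Sum>i<n. cnj (u i) * v i)"
proof -
  have "(\<Sum>j<n. cnj (u i) * unitf i j * v j) = cnj (u i) * v i" if "i < n" for i
  proof -
    have "(\<Sum>j<n. cnj (u i) * unitf i j * v j) = (\<Sum>j<n. if j = i then cnj (u i) * v i else 0)"
      by (intro sum.cong refl) (auto simp: unitf_def)
    then show ?thesis using that by simp
  qed
  then show ?thesis unfolding sesq_def by simp
qed

lemma qform_unit [simp]: "qform n unitf u = sqnorm n u"
  unfolding qform_def sesq_unit sqnorm_def Re_sum
  by (intro sum.cong refl) (simp only: cmod_power2, simp add: power2_eq_square)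

lemma qform_add [simp]: "qform n (\<lambda>i j. X i j + Y i j) u = qform n X u + qform n Y u"
  by (simp add: qform_def sesq_add_mat)

lemma qform_diff [simp]: "qform n (\<lambda>i j. X i j - Y i j) u = qform n X u - qform n Y u"
  by (simp add: qform_def sesq_diff_mat)

lemma qform_scale [simp]: "qform n (\<lambda>i j. of_real c * X i j) u = c * qform n X u"
  by (simp add: qform_def sesq_scale_mat)

lemma qform_scale_vec: "qform n X (\<lambda>i. c * u i) = (cmod c)\<^sup>2 * qform n X u"
proof -
  have "sesq n X (\<lambda>i. c * u i) (\<lambda>i. c * u i) = of_real ((cmod c)\<^sup>2) * sesq n X u u"
    unfolding complex_norm_square sesq_scale_vec by (simp only: ac_simps)
  then show ?thesis unfolding qform_def by simp
qed

lemma sqnorm_nonneg [simp]: "0 \<le> sqnorm n u"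
  by (simp add: sqnorm_def sum_nonneg)

lemma herm_unit [simp]: "herm n unitf"
  by (auto simp: herm_def unitf_def)

lemma herm_add: "herm n X \<Longrightarrow> herm n Y \<Longrightarrow> herm n (\<lambda>i j. X i j + Y i j)"
  and herm_diff: "herm n X \<Longrightarrow> herm n Y \<Longrightarrow> herm n (\<lambda>i j. X i j - Y i j)"
  and herm_scale: "herm n X \<Longrightarrow> herm n (\<lambda>i j. of_real c * X i j)"
  unfolding herm_def
  by (metis complex_cnj_add) (metis complex_cnj_diff, metis complex_cnj_mult complex_cnj_complex_of_real)

lemma pos_semidef_add: "pos_semidef n X \<Longrightarrow> pos_semidef n Y \<Longrightarrow> pos_semidef n (\<lambda>i j. X i j + Y i j)"
  by (simp add: pos_semidef_def herm_add)

lemma pos_semidef_scale: "pos_semidef n X \<Longrightarrow> 0 \<le> c \<Longrightarrow> pos_semidef n (\<lambda>i j. of_real c * X i j)"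
  by (simp add: pos_semidef_def herm_scale)

lemma pos_semidef_unit [simp]: "pos_semidef n unitf"
  by (simp add: pos_semidef_def)

lemma herm_diag:
  assumes "herm n X" "a < n" shows "X a a = of_real (qform n X (unitf a))"
  using sesq_herm_real[OF assms(1), of "unitf a"] sesq_basis[OF assms(2) assms(2)] by simp

section \<open>Cholesky factorisation\<close>

text \<open>If the entry \<open>Q p c\<close> were nonzero, then the form at \<open>e\<^sub>c - s
  e\<^sub>p\<close> with \<open>s = t Q p c\<close> would be affine and nonconstant in the real number
  \<open>t\<close>, hence somewhere negative.\<close>

lemma pos_semidef_zero_diag_row:
  assumes "pos_semidef n Q" "p < n" "Q p p = 0" "c < n"
  shows "Q p c = 0"
proof (rule ccontr)
  assume nz: "Q p c \<noteq> 0"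
  have h: "herm n Q" using assms by (simp add: pos_semidef_def)
  let ?q = "qform n Q (unitf c)"
  define t :: real where "t = (\<bar>?q\<bar> + 1) / (cmod (Q p c))\<^sup>2"
  have cp: "Q c p = cnj (Q p c)" using hermD[OF h] assms by blast
  let ?s = "of_real t * Q p c"
  have "qform n Q (\<lambda>i. unitf c i - ?s * unitf p i) = ?q - 2 * t * (cmod (Q p c))\<^sup>2"
  proof -
    have "sesq n Q (\<lambda>i. unitf c i - ?s * unitf p i) (\<lambda>i. unitf c i - ?s * unitf p i)
       = Q c c - ?s * Q c p - cnj ?s * Q p c + cnj ?s * (?s * Q p p)"
      using assms by (simp only: sesq_diff_vec sesq_scale_vec sesq_basis) (simp add: algebra_simps)
    also have "\<dots> = Q c c - of_real (2 * t) * (Q p c * cnj (Q p c))"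
      by (simp add: assms cp algebra_simps)
    finally show ?thesis
      unfolding qform_def complex_norm_square[symmetric] sesq_basis[OF assms(4) assms(4)] by simp
  qed
  also have "\<dots> = ?q - 2 * (\<bar>?q\<bar> + 1)" unfolding t_def using nz by simp
  also have "\<dots> < 0" by (smt (verit))
  finally show False using assms(1) unfolding pos_semidef_def by (meson not_less)
qed

text \<open>The value of the complement at \<open>u\<close> is the value of \<open>Q\<close> at \<open>u
  - t e\<^sub>p\<close>, where \<open>t\<close> minimises the latter.\<close>

lemma pos_semidef_schur_complement:
  assumes "pos_semidef n Q" "p < n" "Q p p \<noteq> 0"
  shows "pos_semidef n (\<lambda>a c. Q a c - Q a p * Q p c / Q p p)"
proof -
  have h: "herm n Q" using assms by (simp add: pos_semidef_def)
  let ?R = "\<lambda>a c. Q a c - Q a p * Q p c / Q p p"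
  define q where "q = qform n Q (unitf p)"
  have q: "Q p p = of_real q" "q \<noteq> 0" using herm_diag[OF h assms(2)] assms(3) by (auto simp: q_def)
  have hp: "Q a p = cnj (Q p a)" if "a < n" for a using hermD[OF h] that assms by blast
  have hR: "herm n ?R" unfolding herm_def
  proof (intro allI impI)
    fix i j assume ij: "i < n" "j < n"
    then have "Q j i = cnj (Q i j)" using hermD[OF h] by blast
    then show "?R j i = cnj (?R i j)" using hp[OF ij(1)] hp[OF ij(2)] q by simp
  qed
  have "0 \<le> qform n ?R u" for u
  proof -
    define L where "L = sesq n Q (unitf p) u"
    define t where "t = L / of_real q"
    have L1: "(\<Sum>j<n. Q p j * u j) = L"
    proof -
      have "L = (\<Sum>i<n. if i = p then (\<Sum>j<n. Q p j * u j) else 0)"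
        unfolding L_def sesq_def by (intro sum.cong refl) (auto simp: unitf_def)
      then show ?thesis using assms by simp
    qed
    have L2: "(\<Sum>i<n. cnj (u i) * Q i p) = cnj L"
      unfolding L1[symmetric] cnj_sum by (intro sum.cong refl) (auto simp: hp)
    have "sesq n ?R u u = sesq n Q u u - (\<Sum>i<n. \<Sum>j<n. (cnj (u i) * Q i p) * (Q p j * u j) / Q p p)"
      unfolding sesq_def by (simp add: algebra_simps sum_subtractf)
    also have "(\<Sum>i<n. \<Sum>j<n. (cnj (u i) * Q i p) * (Q p j * u j) / Q p p) = cnj L * L / Q p p"
      unfolding L2[symmetric] unfolding L1[symmetric] sum_product by (simp add: sum_divide_distrib)
    finally have 1: "sesq n ?R u u = sesq n Q u u - cnj L * L / of_real q" using q by simp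
    have "sesq n Q (\<lambda>i. u i - t * unitf p i) (\<lambda>i. u i - t * unitf p i)
        = sesq n Q u u - t * cnj L - cnj t * L + cnj t * (t * of_real q)"
      using assms sesq_herm[OF h, of u "unitf p"]
      by (simp only: sesq_diff_vec sesq_scale_vec sesq_basis) (simp add: L_def[symmetric] q algebra_simps)
    also have "\<dots> = sesq n ?R u u" unfolding 1 t_def using q by (simp add: field_simps)
    finally have "qform n ?R u = qform n Q (\<lambda>i. u i - t * unitf p i)"
      unfolding qform_def by (rule arg_cong[of _ _ Re, OF sym])
    then show ?thesis using assms(1) by (simp add: pos_semidef_def)
  qed
  with hR show ?thesis by (simp add: pos_semidef_def)
qed

text \<open>Induction on the size \<open>j\<close> of the lower right block that supports
  \<open>Q\<close>: eliminate its first row and column, either because they vanish or by a Schur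
  complement.\<close>

lemma cholesky_aux:
  assumes "pos_semidef n Q" "j \<le> n"
    and "\<And>a c. a < n \<Longrightarrow> c < n \<Longrightarrow> a < n - j \<or> c < n - j \<Longrightarrow> Q a c = 0"
  shows "\<exists>T. (\<forall>e<n-j. \<forall>a. T e a = 0) \<and> (\<forall>a<n. \<forall>c<n. Q a c = (\<Sum>e<n. T e a * cnj (T e c)))"
  using assms
proof (induction j arbitrary: Q)
  case 0
  then show ?case by (intro exI[of _ "\<lambda>e a. 0"]) auto
next
  case (Suc j)
  define p where "p = n - Suc j"
  have p: "p < n" "n - j = Suc p" using Suc.prems by (auto simp: p_def)
  have h: "herm n Q" using Suc.prems by (simp add: pos_semidef_def)
  have hp: "Q a p = cnj (Q p a)" if "a < n" for a using hermD[OF h] that p by blast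
  show ?case
  proof (cases "Q p p = 0")
    case True
    have row: "Q p c = 0" if "c < n" for c
      using pos_semidef_zero_diag_row[OF Suc.prems(1) p(1) True that] .
    then have col: "Q c p = 0" if "c < n" for c using hp that by simp
    have "\<exists>T. (\<forall>e<n-j. \<forall>a. T e a = 0) \<and> (\<forall>a<n. \<forall>c<n. Q a c = (\<Sum>e<n. T e a * cnj (T e c)))"
    proof (rule Suc.IH)
      fix a c assume "a < n" "c < n" "a < n - j \<or> c < n - j"
      then show "Q a c = 0" using row col Suc.prems(3)[of a c] p
        by (metis less_Suc_eq p_def)
    qed (use Suc.prems in auto)
    then show ?thesis using p by (metis less_SucI p_def)
  next
    case False
    define q where "q = qform n Q (unitf p)"
    have q: "Q p p = of_real q" "q \<noteq> 0" using herm_diag[OF h p(1)] False by (auto simp: q_def)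
    have "q > 0" using Suc.prems(1) q(2) unfolding q_def pos_semidef_def by (metis less_eq_real_def)
    define R where "R = (\<lambda>a c. Q a c - Q a p * Q p c / Q p p)"
    have "\<exists>T. (\<forall>e<n-j. \<forall>a. T e a = 0) \<and> (\<forall>a<n. \<forall>c<n. R a c = (\<Sum>e<n. T e a * cnj (T e c)))"
    proof (rule Suc.IH)
      show "pos_semidef n R" unfolding R_def using pos_semidef_schur_complement[OF Suc.prems(1) p(1) False] .
      fix a c assume ac: "a < n" "c < n" "a < n - j \<or> c < n - j"
      then have "a < p \<or> c < p \<or> a = p \<or> c = p" using p by auto
      then show "R a c = 0" using Suc.prems(3)[of a c] Suc.prems(3)[of a p] Suc.prems(3)[of p c] ac p False
        unfolding R_def by (auto simp: p_def)
    qed (use Suc.prems in auto)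
    then obtain T where T: "\<And>e a. e < Suc p \<Longrightarrow> T e a = 0"
      "\<And>a c. a < n \<Longrightarrow> c < n \<Longrightarrow> R a c = (\<Sum>e<n. T e a * cnj (T e c))" unfolding p(2) by blast
    define T' where "T' = T(p := (\<lambda>a. Q a p / of_real (sqrt q)))"
    have "Q a c = (\<Sum>e<n. T' e a * cnj (T' e c))" if "a < n" "c < n" for a c
    proof -
      have "(\<Sum>e<n. T' e a * cnj (T' e c))
          = (\<Sum>e<n. T e a * cnj (T e c) + (if e = p then Q a p * Q p c / Q p p else 0))"
      proof (intro sum.cong refl)
        fix e
        have "complex_of_real (sqrt q) * complex_of_real (sqrt q) = of_real q"
          using \<open>q > 0\<close> by (simp flip: of_real_mult)
        then show "T' e a * cnj (T' e c) = T e a * cnj (T e c) + (if e = p then Q a p * Q p c / Q p p else 0)"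
          using T(1)[of p] hp[OF that(2)] q by (simp add: T'_def)
      qed
      also have "\<dots> = R a c + Q a p * Q p c / Q p p" using p T(2)[OF that] by (simp add: sum.distrib)
      finally show ?thesis by (simp add: R_def)
    qed
    moreover have "\<forall>e<n - Suc j. \<forall>a. T' e a = 0" using T(1) by (auto simp: T'_def p_def[symmetric])
    ultimately show ?thesis by blast
  qed
qed

lemma cholesky:
  assumes "pos_semidef n Q"
  obtains T where "\<And>a c. a < n \<Longrightarrow> c < n \<Longrightarrow> Q a c = (\<Sum>e<n. T e a * cnj (T e c))"
  using cholesky_aux[OF assms order_refl] by auto

section \<open>The trace pairing\<close>

lemma pairing_add_right: "pairing n B (\<lambda>a c. X a c + Y a c) = pairing n B X + pairing n B Y"
  by (simp add: pairing_def algebra_simps sum.distrib)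

lemma pairing_diff_right: "pairing n B (\<lambda>a c. X a c - Y a c) = pairing n B X - pairing n B Y"
  by (simp add: pairing_def algebra_simps sum_subtractf)

lemma pairing_scale_right: "pairing n B (\<lambda>a c. of_real t * Y a c) = t * pairing n B Y"
proof -
  have "(\<Sum>a<n. \<Sum>c<n. B a c * (of_real t * Y a c)) = of_real t * (\<Sum>a<n. \<Sum>c<n. B a c * Y a c)"
    by (simp add: sum_distrib_left algebra_simps)
  then show ?thesis by (simp add: pairing_def)
qed

lemma pairing_commute: "pairing n B Y = pairing n Y B"
  by (simp add: pairing_def mult.commute)

lemma pairing_add_left: "pairing n (\<lambda>a c. X a c + Y a c) B = pairing n X B + pairing n Y B"
  and pairing_diff_left: "pairing n (\<lambda>a c. X a c - Y a c) B = pairing n X B - pairing n Y B"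
  and pairing_scale_left: "pairing n (\<lambda>a c. of_real t * Y a c) B = t * pairing n Y B"
  by (simp_all only: pairing_commute[of n _ B] pairing_add_right pairing_diff_right pairing_scale_right)

lemma pairing_cong:
  assumes "\<And>a c. a < n \<Longrightarrow> c < n \<Longrightarrow> B a c = B' a c" "\<And>a c. a < n \<Longrightarrow> c < n \<Longrightarrow> Y a c = Y' a c"
  shows "pairing n B Y = pairing n B' Y'"
  unfolding pairing_def using assms by (intro arg_cong[of _ _ Re] sum.cong refl) auto

lemma pairing_rank_one: "pairing n B (\<lambda>a c. cnj (u a) * u c) = qform n B u"
  by (simp add: pairing_def qform_def sesq_def algebra_simps)

lemma pairing_unit: "pairing n B unitf = (\<Sum>a<n. Re (B a a))"
proof -
  have "(\<Sum>c<n. B a c * unitf a c) = B a a" if "a < n" for a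
  proof -
    have "(\<Sum>c<n. B a c * unitf a c) = (\<Sum>c<n. if c = a then B a a else 0)"
      by (intro sum.cong refl) (auto simp: unitf_def)
    then show ?thesis using that by simp
  qed
  then show ?thesis by (simp add: pairing_def)
qed

text \<open>Factor \<open>E\<close> into rank-one matrices; on each of them the pairing is a value of the
  form of \<open>B\<close>.\<close>

lemma pairing_nonneg:
  assumes "pos_semidef n B" "pos_semidef n E"
  shows "0 \<le> pairing n B E"
proof -
  obtain T where T: "\<And>a c. a < n \<Longrightarrow> c < n \<Longrightarrow> E a c = (\<Sum>e<n. T e a * cnj (T e c))"
    using cholesky[OF assms(2)] by blast
  have "(\<Sum>a<n. \<Sum>c<n. B a c * E a c) = (\<Sum>a<n. \<Sum>c<n. \<Sum>e<n. B a c * (T e a * cnj (T e c)))"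
    using T by (intro sum.cong refl) (simp add: sum_distrib_left)
  also have "\<dots> = (\<Sum>a<n. \<Sum>e<n. \<Sum>c<n. B a c * (T e a * cnj (T e c)))"
    by (intro sum.cong refl sum.swap)
  also have "\<dots> = (\<Sum>e<n. \<Sum>a<n. \<Sum>c<n. B a c * (T e a * cnj (T e c)))"
    by (rule sum.swap)
  also have "\<dots> = (\<Sum>e<n. sesq n B (\<lambda>a. cnj (T e a)) (\<lambda>a. cnj (T e a)))"
    unfolding sesq_def by (intro sum.cong refl) (simp add: algebra_simps)
  finally have "pairing n B E = (\<Sum>e<n. qform n B (\<lambda>a. cnj (T e a)))"
    by (simp add: pairing_def qform_def)
  then show ?thesis using assms(1) unfolding pos_semidef_def by (simp add: sum_nonneg)
qed

text \<open>The duality of operator norm and trace norm, with both norms expressed by semidefinite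
  inequalities.  All pairings of \<open>1 \<plusminus> B\<close> with \<open>r P \<plusminus> Y\<close>
  are nonnegative; the sum of the two with opposite signs gives the upper bound, that of the two with
  equal signs the lower bound.\<close>

lemma pairing_abs_bound:
  assumes "pos_semidef n (\<lambda>a c. unitf a c + B a c)" "pos_semidef n (\<lambda>a c. unitf a c - B a c)"
    and "pos_semidef n (\<lambda>a c. of_real r * P a c + Y a c)" "pos_semidef n (\<lambda>a c. of_real r * P a c - Y a c)"
  shows "\<bar>pairing n B Y\<bar> \<le> r * pairing n unitf P"
proof -
  have "0 \<le> pairing n (\<lambda>a c. unitf a c + B a c) (\<lambda>a c. of_real r * P a c - Y a c)"
    "0 \<le> pairing n (\<lambda>a c. unitf a c - B a c) (\<lambda>a c. of_real r * P a c + Y a c)"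
    "0 \<le> pairing n (\<lambda>a c. unitf a c + B a c) (\<lambda>a c. of_real r * P a c + Y a c)"
    "0 \<le> pairing n (\<lambda>a c. unitf a c - B a c) (\<lambda>a c. of_real r * P a c - Y a c)"
    using assms pairing_nonneg by blast+
  then show ?thesis
    unfolding pairing_add_left pairing_diff_left pairing_add_right pairing_diff_right pairing_scale_right
    by linarith
qed

lemma pos_semidef_entry_le_trace:
  assumes "pos_semidef n Q" "a < n" "c < n"
  shows "cmod (Q a c) \<le> pairing n unitf Q"
proof -
  obtain T where T: "\<And>a c. a < n \<Longrightarrow> c < n \<Longrightarrow> Q a c = (\<Sum>e<n. T e a * cnj (T e c))"
    using cholesky[OF assms(1)] by blast
  have diag: "Re (Q b b) = (\<Sum>e<n. (cmod (T e b))\<^sup>2)" if "b < n" for b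
    using T[OF that that] by (simp only: complex_norm_square[symmetric] Re_sum Re_complex_of_real)
  have nn: "0 \<le> Re (Q b b)" if "b < n" for b using diag[OF that] by (simp add: sum_nonneg)
  have le: "Re (Q b b) \<le> pairing n unitf Q" if "b < n" for b
    unfolding pairing_commute[of n unitf] pairing_unit using that nn by (intro member_le_sum) auto
  have "cmod (Q a c) \<le> (\<Sum>e<n. cmod (T e a) * cmod (T e c))"
    unfolding T[OF assms(2,3)] by (rule order.trans[OF norm_sum]) (simp add: norm_mult)
  also have "\<dots> \<le> (\<Sum>e<n. ((cmod (T e a))\<^sup>2 + (cmod (T e c))\<^sup>2) / 2)"
  proof (intro sum_mono)
    fix e
    show "cmod (T e a) * cmod (T e c) \<le> ((cmod (T e a))\<^sup>2 + (cmod (T e c))\<^sup>2) / 2"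
      using sum_squares_bound[of "cmod (T e a)" "cmod (T e c)"] by simp
  qed
  also have "\<dots> = (Re (Q a a) + Re (Q c c)) / 2"
    unfolding diag[OF assms(2)] diag[OF assms(3)] by (simp add: sum.distrib sum_divide_distrib[symmetric])
  also have "\<dots> \<le> pairing n unitf Q" using le[OF assms(2)] le[OF assms(3)] by simp
  finally show ?thesis .
qed

text \<open>This crude bound serves only to control vectors of the cone by the trace of their first
  component; constants depending on the size are harmless there.\<close>

lemma bounded_entry:
  assumes "pos_semidef n (\<lambda>a c. of_real r * P a c + Y a c)" "pos_semidef n (\<lambda>a c. of_real r * P a c - Y a c)"
    and "a < n" "c < n"
  shows "cmod (Y a c) \<le> r * pairing n unitf P"
proof -
  have "2 * cmod (Y a c) = cmod ((of_real r * P a c + Y a c) - (of_real r * P a c - Y a c))"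
    by (metis add_diff_cancel_left' add_diff_eq diff_diff_eq2 mult_2 norm_mult norm_numeral add.commute)
  also have "\<dots> \<le> cmod (of_real r * P a c + Y a c) + cmod (of_real r * P a c - Y a c)"
    by (rule norm_triangle_ineq4)
  also have "\<dots> \<le> 2 * (r * pairing n unitf P)"
    using pos_semidef_entry_le_trace[OF assms(1,3,4)] pos_semidef_entry_le_trace[OF assms(2,3,4)]
    unfolding pairing_add_right pairing_diff_right pairing_scale_right by linarith
  finally show ?thesis by simp
qed

text \<open>A kernel vector of \<open>T\<^sup>*\<close> would be a null vector of the form of
  \<open>W\<close>, so a definite form has an invertible factor.\<close>

lemma invertible_factor:
  assumes W: "pos_semidef n W" "\<And>u. sqnorm n u \<noteq> 0 \<Longrightarrow> 0 < qform n W u"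
  obtains T S :: "nat \<Rightarrow> nat \<Rightarrow> complex" where
    "\<And>a c. a < n \<Longrightarrow> c < n \<Longrightarrow> W a c = (\<Sum>e<n. T a e * cnj (T c e))"
    "\<And>a c. a < n \<Longrightarrow> c < n \<Longrightarrow> (\<Sum>e<n. S a e * T e c) = unitf a c"
    "\<And>a c. a < n \<Longrightarrow> c < n \<Longrightarrow> (\<Sum>e<n. T a e * S e c) = unitf a c"
proof -
  obtain T0 where T0: "\<And>a c. a < n \<Longrightarrow> c < n \<Longrightarrow> W a c = (\<Sum>e<n. T0 e a * cnj (T0 e c))"
    using cholesky[OF W(1)] by blast
  define M where "M = mat n n (\<lambda>(e, a). cnj (T0 e a))"
  have M: "M \<in> carrier_mat n n" by (simp add: M_def)
  have "det M \<noteq> 0"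
  proof
    assume "det M = 0"
    then obtain v where v: "v \<in> carrier_vec n" "v \<noteq> 0\<^sub>v n" "M *\<^sub>v v = 0\<^sub>v n"
      using det_0_iff_vec_prod_zero[OF M] by blast
    let ?u = "\<lambda>i. v $ i"
    have z: "(\<Sum>j<n. cnj (T0 e j) * ?u j) = 0" if "e < n" for e
    proof -
      have "(M *\<^sub>v v) $ e = (\<Sum>j<n. cnj (T0 e j) * ?u j)"
        using that v(1) M by (auto simp: M_def scalar_prod_def atLeast0LessThan intro!: sum.cong)
      then show ?thesis using v(3) that by simp
    qed
    have "sesq n W ?u ?u = (\<Sum>i<n. \<Sum>j<n. \<Sum>e<n. cnj (?u i) * T0 e i * (cnj (T0 e j) * ?u j))"
      unfolding sesq_def using T0
      by (intro sum.cong refl) (simp add: sum_distrib_left sum_distrib_right algebra_simps)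
    also have "\<dots> = (\<Sum>i<n. \<Sum>e<n. \<Sum>j<n. cnj (?u i) * T0 e i * (cnj (T0 e j) * ?u j))"
      by (intro sum.cong refl sum.swap)
    also have "\<dots> = 0"
      by (simp add: sum_distrib_left[symmetric] z)
    finally have "qform n W ?u = 0" by (simp add: qform_def)
    then have "sqnorm n ?u = 0" using W(2)[of ?u] by fastforce
    then have "\<forall>i<n. v $ i = 0" unfolding sqnorm_def by (simp add: sum_nonneg_eq_0_iff)
    then show False using v(1,2) by auto
  qed
  from det_non_zero_imp_unit[OF M this, of "()"]
  obtain N where N: "N \<in> carrier_mat n n" "N * M = 1\<^sub>m n" "M * N = 1\<^sub>m n"
    unfolding Units_def ring_mat_def by auto
  have ix: "(\<Sum>e<n. A $$ (a, e) * B $$ (e, c)) = unitf a c"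
    if "A \<in> carrier_mat n n" "B \<in> carrier_mat n n" "A * B = 1\<^sub>m n" "a < n" "c < n" for A B a c
  proof -
    have "(A * B) $$ (a, c) = (\<Sum>e<n. A $$ (a, e) * B $$ (e, c))"
      using that(1,2,4,5) by (auto simp: scalar_prod_def atLeast0LessThan intro!: sum.cong)
    then show ?thesis using that by (simp add: unitf_def)
  qed
  show thesis
  proof (rule that[of "\<lambda>a e. T0 e a" "\<lambda>e a. cnj (N $$ (a, e))"])
    fix a c assume ac: "a < n" "c < n"
    show "W a c = (\<Sum>e<n. T0 e a * cnj (T0 e c))" using T0 ac by simp
    have Me: "cnj (M $$ (e, b)) = T0 e b" if "e < n" "b < n" for e b using that by (simp add: M_def)
    have "(\<Sum>e<n. cnj (N $$ (e, a)) * T0 c e) = cnj (\<Sum>e<n. M $$ (c, e) * N $$ (e, a))"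
      unfolding cnj_sum using Me ac by (intro sum.cong refl) (simp add: mult.commute)
    then show "(\<Sum>e<n. cnj (N $$ (e, a)) * T0 c e) = unitf a c"
      using ix[OF M N(1,3) ac(2,1)] by (simp add: unitf_def)
    have "(\<Sum>e<n. T0 e a * cnj (N $$ (c, e))) = cnj (\<Sum>e<n. N $$ (c, e) * M $$ (e, a))"
      unfolding cnj_sum using Me ac by (intro sum.cong refl) (simp add: mult.commute)
    then show "(\<Sum>e<n. T0 e a * cnj (N $$ (c, e))) = unitf a c"
      using ix[OF N(1) M N(2) ac(2,1)] by (simp add: unitf_def)
  qed
qed

section \<open>Separation from a convex cone\<close>

text \<open>A nearest point of the cone need not be available, as the cone is not assumed closed.  A
  point \<open>y\<close> whose distance to \<open>x\<close> is nearly minimal does almost the same: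
  moving from \<open>y\<close> in the direction of a vector of the cone, or towards 0, cannot shorten the
  distance by much, and this bounds the first-order term from below.\<close>

lemma cone_approximate_separation:
  fixes x :: "'i \<Rightarrow> complex" and K :: "('i \<Rightarrow> complex) set"
  defines "ip I f g \<equiv> (\<Sum>i\<in>I. Re (cnj (f i) * g i))"
  assumes "finite I" and zero: "(\<lambda>i. 0) \<in> K"
    and add: "\<And>y z. y \<in> K \<Longrightarrow> z \<in> K \<Longrightarrow> (\<lambda>i. y i + z i) \<in> K"
    and scale: "\<And>y t. y \<in> K \<Longrightarrow> 0 \<le> t \<Longrightarrow> (\<lambda>i. of_real t * y i) \<in> K"
    and far: "\<And>y. y \<in> K \<Longrightarrow> r\<^sup>2 \<le> (\<Sum>i\<in>I. (cmod (x i - y i))\<^sup>2)"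
    and "0 < \<eta>"
  obtains y where "y \<in> K"
    "\<And>z. z \<in> K \<Longrightarrow> - \<eta> * sqrt (\<Sum>i\<in>I. (cmod (z i))\<^sup>2) \<le> ip I (\<lambda>i. y i - x i) z"
    "ip I (\<lambda>i. y i - x i) x \<le> \<eta> - r\<^sup>2"
proof -
  define nn where "nn f = (\<Sum>i\<in>I. (cmod (f i))\<^sup>2)" for f :: "'i \<Rightarrow> complex"
  have nn0 [simp]: "0 \<le> nn f" for f by (simp add: nn_def sum_nonneg)
  have expand: "nn (\<lambda>i. f i + of_real t * g i) = nn f + 2 * t * ip I f g + t\<^sup>2 * nn g" for f g t
  proof -
    have "(cmod (f i + of_real t * g i))\<^sup>2
        = (cmod (f i))\<^sup>2 + 2 * t * Re (cnj (f i) * g i) + t\<^sup>2 * (cmod (g i))\<^sup>2" for i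
      by (simp only: cmod_power2) (simp add: power2_eq_square algebra_simps)
    then show ?thesis by (simp only: nn_def ip_def sum.distrib sum_distrib_left)
  qed
  define \<rho> where "\<rho> = Inf ((\<lambda>y. nn (\<lambda>i. x i - y i)) ` K)"
  have bdd: "bdd_below ((\<lambda>y. nn (\<lambda>i. x i - y i)) ` K)" by (rule bdd_belowI[of _ 0]) auto
  have rho_le: "\<rho> \<le> nn (\<lambda>i. y i - x i)" if "y \<in> K" for y
  proof -
    have "\<rho> \<le> nn (\<lambda>i. x i - y i)" unfolding \<rho>_def using bdd that by (intro cInf_lower) auto
    then show ?thesis by (simp add: nn_def norm_minus_commute)
  qed
  have rho_x: "\<rho> \<le> nn x" using rho_le[OF zero] by (simp add: nn_def)
  have r_rho: "r\<^sup>2 \<le> \<rho>" unfolding \<rho>_def using zero far by (intro cInf_greatest) (auto simp: nn_def)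
  define L where "L = 4 * nn x + 2"
  \<comment> \<open>\<open>L\<close> bounds the squared length of every nearly nearest point; \<open>\<kappa>\<close> is the
    tolerance for such a point, small enough for the step towards 0 below.\<close>
  define \<kappa> where "\<kappa> = min 1 (\<eta> / L)"
  have L: "2 \<le> L" by (simp add: L_def)
  have k: "0 < \<kappa>" "\<kappa> \<le> 1" "\<kappa> * L \<le> \<eta>" "\<kappa> \<le> \<eta>"
  proof -
    show "0 < \<kappa>" "\<kappa> \<le> 1" using \<open>0 < \<eta>\<close> L by (auto simp: \<kappa>_def)
    have "\<kappa> \<le> \<eta> / L" by (simp add: \<kappa>_def)
    then show "\<kappa> * L \<le> \<eta>" using L by (simp add: field_simps)
    moreover have "\<kappa> * 1 \<le> \<kappa> * L" using L \<open>0 < \<kappa>\<close> by (intro mult_left_mono) auto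
    ultimately show "\<kappa> \<le> \<eta>" by simp
  qed
  have "\<rho> < \<rho> + \<kappa>\<^sup>2" using k by simp
  then obtain y where y: "y \<in> K" "nn (\<lambda>i. x i - y i) < \<rho> + \<kappa>\<^sup>2"
    using cInf_lessD[of "(\<lambda>y. nn (\<lambda>i. x i - y i)) ` K" "\<rho> + \<kappa>\<^sup>2", folded \<rho>_def] zero by blast
  define f where "f = (\<lambda>i. y i - x i)"
  have nf: "nn f < \<rho> + \<kappa>\<^sup>2" using y(2) by (simp add: nn_def f_def norm_minus_commute)
  have key: "0 \<le> \<kappa>\<^sup>2 + 2 * t * ip I f z + t\<^sup>2 * nn z"
    if "(\<lambda>i. y i + of_real t * z i) \<in> K" for t z
  proof -
    have "\<rho> \<le> nn (\<lambda>i. f i + of_real t * z i)"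
      using rho_le[OF that] by (simp add: f_def algebra_simps)
    then show ?thesis using nf unfolding expand by linarith
  qed
  have 1: "- \<eta> * sqrt (nn z) \<le> ip I f z" if z: "z \<in> K" for z
  proof (cases "nn z = 0")
    case True
    then have "\<forall>i\<in>I. z i = 0" using \<open>finite I\<close> by (auto simp: nn_def sum_nonneg_eq_0_iff)
    then show ?thesis using True by (simp add: ip_def)
  next
    case False
    define l where "l = sqrt (nn z)"
    have l: "0 < l" "nn z = l\<^sup>2" using False nn0[of z] by (auto simp: l_def less_le)
    have "0 \<le> \<kappa>\<^sup>2 + 2 * (\<kappa> / l) * ip I f z + (\<kappa> / l)\<^sup>2 * nn z"
      using key[OF add[OF y(1) scale[OF z, of "\<kappa> / l"]]] k l by simp
    also have "\<dots> = 2 * (\<kappa> / l) * (ip I f z + \<kappa> * l)"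
      using l by (simp add: field_simps power2_eq_square)
    finally have "0 \<le> ip I f z + \<kappa> * l" using k l by (simp add: zero_le_mult_iff zero_le_divide_iff)
    moreover have "\<kappa> * l \<le> \<eta> * l" using k l by simp
    ultimately show ?thesis unfolding l_def by linarith
  qed
  have 2: "ip I f x \<le> \<eta> - r\<^sup>2"
  proof -
    have "nn f \<le> nn x + 1" using nf rho_x k power_le_one[of \<kappa> 2] by linarith
    moreover have "nn y \<le> 2 * nn x + 2 * nn f"
    proof -
      have "(cmod (y i))\<^sup>2 \<le> 2 * (cmod (x i))\<^sup>2 + 2 * (cmod (f i))\<^sup>2" for i
      proof -
        have "(cmod (y i))\<^sup>2 \<le> (cmod (x i) + cmod (f i))\<^sup>2"
          using norm_triangle_ineq[of "x i" "f i"] by (intro power_mono) (auto simp: f_def)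
        also have "\<dots> \<le> 2 * (cmod (x i))\<^sup>2 + 2 * (cmod (f i))\<^sup>2"
          using sum_squares_bound[of "cmod (x i)" "cmod (f i)"] by (simp add: power2_sum)
        finally show ?thesis .
      qed
      then show ?thesis unfolding nn_def sum_distrib_left sum.distrib[symmetric] by (rule sum_mono)
    qed
    ultimately have ny: "nn y \<le> L" by (simp add: L_def)
    let ?s = "\<kappa> / L"
    have s: "0 < ?s" "?s \<le> 1" using k L by (auto simp: field_simps)
    have "(\<lambda>i. of_real (1 - ?s) * y i) \<in> K" using s by (intro scale[OF y(1)]) linarith
    moreover have "(\<lambda>i. of_real (1 - ?s) * y i) = (\<lambda>i. y i + of_real (- ?s) * y i)"
      by (simp add: algebra_simps fun_eq_iff)
    ultimately have "0 \<le> \<kappa>\<^sup>2 + 2 * (- ?s) * ip I f y + (- ?s)\<^sup>2 * nn y" by (intro key) (simp only:)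
    also have "\<dots> \<le> \<kappa>\<^sup>2 + 2 * (- ?s) * ip I f y + ?s\<^sup>2 * L\<^sup>2"
    proof -
      have "L * 1 \<le> L * L" using L by (intro mult_left_mono) auto
      then have "nn y \<le> L\<^sup>2" using ny by (simp add: power2_eq_square)
      then show ?thesis by (simp add: mult_left_mono)
    qed
    also have "\<dots> = 2 * ?s * (\<kappa> * L - ip I f y)"
      using L by (simp add: field_simps power2_eq_square)
    finally have "ip I f y \<le> \<kappa> * L" using s(1) by (simp only: zero_le_mult_iff) auto
    moreover have "ip I f y = nn f + ip I f x"
    proof -
      have "Re (cnj (f i) * y i) = (cmod (f i))\<^sup>2 + Re (cnj (f i) * x i)" for i
      proof -
        have "cnj (f i) * y i = f i * cnj (f i) + cnj (f i) * x i" by (simp add: f_def algebra_simps)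
        then show ?thesis unfolding complex_norm_square[symmetric] by simp
      qed
      then show ?thesis by (simp add: ip_def nn_def sum.distrib)
    qed
    moreover have "r\<^sup>2 \<le> nn f" using rho_le[OF y(1)] r_rho by (simp add: f_def)
    ultimately show ?thesis using k by linarith
  qed
  show thesis using that[OF y(1)] 1 2 unfolding f_def nn_def by blast
qed

section \<open>Compressions of matrices\<close>

definition entry :: "complex mat \<Rightarrow> nat \<Rightarrow> nat \<Rightarrow> complex" where
  "entry A i j = A $$ (i, j)"

text \<open>The component with index 0 is the identity, so that an affine polynomial becomes a linear
  expression in the components \<open>0, \<dots>, d\<close>.\<close>

definition coord :: "complex mat list \<Rightarrow> nat \<Rightarrow> nat \<Rightarrow> nat \<Rightarrow> complex" where
  "coord X j = (case j of 0 \<Rightarrow> unitf | Suc i \<Rightarrow> entry (X ! i))"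

text \<open>The matrix of \<open>V\<^sup>*XV\<close>, where \<open>V a\<close> is column \<open>a\<close>
  of \<open>V\<close>.\<close>

definition compress :: "nat \<Rightarrow> (nat \<Rightarrow> nat \<Rightarrow> complex) \<Rightarrow> (nat \<Rightarrow> nat \<Rightarrow> complex) \<Rightarrow> nat \<Rightarrow> nat \<Rightarrow> complex" where
  "compress k X V a c = sesq k X (V a) (V c)"

lemma sesq_compress:
  "sesq n (compress k X V) u v = sesq k X (\<lambda>i. \<Sum>a<n. u a * V a i) (\<lambda>i. \<Sum>c<n. v c * V c i)"
  unfolding sesq_sum_left sesq_sum_right
  by (simp add: sesq_def[of n] compress_def sum_distrib_left algebra_simps)

lemma qform_compress: "qform n (compress k X V) u = qform k X (\<lambda>i. \<Sum>a<n. u a * V a i)"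
  by (simp add: qform_def sesq_compress)

lemma herm_compress: "herm k X \<Longrightarrow> herm n (compress k X V)"
  unfolding herm_def[of n] compress_def using sesq_herm by blast

lemma pos_semidef_compress: "pos_semidef k X \<Longrightarrow> pos_semidef n (compress k X V)"
  by (simp add: pos_semidef_def herm_compress qform_compress)

lemma mult_vec_entry:
  assumes "A \<in> carrier_mat N M" "v \<in> carrier_vec M" "i < N"
  shows "(A *\<^sub>v v) $ i = (\<Sum>j<M. entry A i j * v $ j)"
  using assms by (auto simp: scalar_prod_def atLeast0LessThan entry_def intro!: sum.cong)

lemma inner_mult_vec:
  assumes "A \<in> carrier_mat n n" "v \<in> carrier_vec n" "w \<in> carrier_vec n"
  shows "(A *\<^sub>v v) \<bullet>c w = sesq n (entry A) (\<lambda>i. w $ i) (\<lambda>i. v $ i)"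
proof -
  have "(A *\<^sub>v v) \<bullet>c w = (\<Sum>i<n. (A *\<^sub>v v) $ i * cnj (w $ i))"
    using assms by (auto simp: scalar_prod_def atLeast0LessThan intro!: sum.cong)
  also have "\<dots> = (\<Sum>i<n. (\<Sum>j<n. entry A i j * v $ j) * cnj (w $ i))"
    using mult_vec_entry[OF assms(1,2)] by simp
  finally show ?thesis by (simp add: sesq_def sum_distrib_left sum_distrib_right algebra_simps)
qed

lemma psd_iff:
  assumes "A \<in> carrier_mat n n"
  shows "psd n A \<longleftrightarrow> (\<forall>u. 0 \<le> sesq n (entry A) u u)"
proof
  assume p: "psd n A"
  show "\<forall>u. 0 \<le> sesq n (entry A) u u"
  proof
    fix u
    have "0 \<le> (A *\<^sub>v vec n u) \<bullet>c vec n u" using p unfolding psd_def by auto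
    also have "\<dots> = sesq n (entry A) u u"
      unfolding inner_mult_vec[OF assms vec_carrier vec_carrier] by (rule sesq_cong) auto
    finally show "0 \<le> sesq n (entry A) u u" .
  qed
next
  assume "\<forall>u. 0 \<le> sesq n (entry A) u u"
  then show "psd n A" unfolding psd_def using assms inner_mult_vec[OF assms] by auto
qed

section \<open>Complete positivity of compressions\<close>

lemma sum_lessThan_mult:
  fixes f :: "nat \<Rightarrow> 'a::comm_monoid_add"
  shows "(\<Sum>i<m * k. f i) = (\<Sum>p<m. \<Sum>a<k. f (p * k + a))"
proof (induction m)
  case (Suc m)
  have "(\<Sum>i<q + l. f i) = (\<Sum>i<q. f i) + (\<Sum>i<l. f (q + i))" for q l :: nat
    by (induction l) (auto simp: add.assoc)
  from this[of "m * k" k] Suc show ?case by (simp add: add.commute)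
qed simp

text \<open>An index below \<open>m * k\<close> is a pair of a block index and an index within the
  block.\<close>

lemma sesq_mult_index:
  "sesq (m * k) X u v =
    (\<Sum>p<m. \<Sum>q<m. sesq k (\<lambda>i j. X (p * k + i) (q * k + j)) (\<lambda>i. u (p * k + i)) (\<lambda>j. v (q * k + j)))"
proof -
  have "sesq (m * k) X u v = (\<Sum>p<m. \<Sum>a<k. \<Sum>q<m. \<Sum>c<k.
      cnj (u (p * k + a)) * X (p * k + a) (q * k + c) * v (q * k + c))"
    unfolding sesq_def sum_lessThan_mult ..
  also have "\<dots> = (\<Sum>p<m. \<Sum>q<m. \<Sum>a<k. \<Sum>c<k.
      cnj (u (p * k + a)) * X (p * k + a) (q * k + c) * v (q * k + c))"
    by (intro sum.cong refl sum.swap)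
  finally show ?thesis unfolding sesq_def .
qed

lemma mult_add_less: "p < m \<Longrightarrow> a < k \<Longrightarrow> p * k + a < m * (k::nat)"
  by (metis add.commute div_less div_mult_self3 div_less_iff_less_mult add_cancel_right_left less_nat_zero_code mult_0_right neq0_conv)

definition compression :: "nat \<Rightarrow> nat \<Rightarrow> (nat \<Rightarrow> nat \<Rightarrow> complex) \<Rightarrow> complex mat \<Rightarrow> complex mat" where
  "compression k n V M = mat n n (\<lambda>(a, c). compress k (entry M) V a c)"

text \<open>The ampliation of \<open>V\<^sup>* \<cdot> V\<close> is compression by \<open>1 \<otimes>
  V\<close>, so its form at \<open>u\<close> is the form of \<open>P\<close> at \<open>(1 \<otimes> V)
  u\<close>.\<close>

lemma completely_positive_compression: "completely_positive k n (compression k n V)"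
proof -
  have lin: "linear_map_mat k n (compression k n V)"
    unfolding linear_map_mat_def
  proof (intro conjI ballI allI)
    fix A B :: "complex mat" and c assume A: "A \<in> carrier_mat k k"
    show "compression k n V A \<in> carrier_mat n n" by (simp add: compression_def)
    have "compress k (entry (c \<cdot>\<^sub>m A)) V a b = c * compress k (entry A) V a b" for a b
      unfolding compress_def sesq_scale_mat[symmetric]
      using A by (intro sesq_cong) (auto simp: entry_def)
    then show "compression k n V (c \<cdot>\<^sub>m A) = c \<cdot>\<^sub>m compression k n V A"
      by (intro eq_matI) (auto simp: compression_def)
    assume B: "B \<in> carrier_mat k k"
    have "compress k (entry (A + B)) V a b = compress k (entry A) V a b + compress k (entry B) V a b" for a b
      unfolding compress_def sesq_add_mat[symmetric]
      using A B by (intro sesq_cong) (auto simp: entry_def)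
    then show "compression k n V (A + B) = compression k n V A + compression k n V B"
      by (intro eq_matI) (auto simp: compression_def)
  qed
  have "psd (m * n) (ampliation m k n (compression k n V) P)" if P: "psd (m * k) P" for m P
  proof -
    let ?A = "ampliation m k n (compression k n V) P"
    have Pc: "P \<in> carrier_mat (m * k) (m * k)" using P by (simp add: psd_def)
    have Ac: "?A \<in> carrier_mat (m * n) (m * n)" by (simp add: ampliation_def)
    have "0 \<le> sesq (m * n) (entry ?A) u u" for u
    proof -
      let ?U = "\<lambda>p i. \<Sum>a<n. u (p * n + a) * V a i"
      define w where "w = (\<lambda>i. ?U (i div k) (i mod k))"
      have "sesq (m * n) (entry ?A) u u
          = (\<Sum>p<m. \<Sum>q<m. sesq n (compress k (entry (block_of k P p q)) V)
              (\<lambda>a. u (p * n + a)) (\<lambda>c. u (q * n + c)))"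
        unfolding sesq_mult_index
      proof (intro sum.cong refl sesq_cong)
        fix p q a c assume "p \<in> {..<m}" "q \<in> {..<m}" "a < n" "c < n"
        then show "entry ?A (p * n + a) (q * n + c) = compress k (entry (block_of k P p q)) V a c"
          using mult_add_less by (simp add: entry_def ampliation_def compression_def)
      qed
      also have "\<dots> = (\<Sum>p<m. \<Sum>q<m. sesq k (\<lambda>i j. entry P (p * k + i) (q * k + j))
              (\<lambda>i. w (p * k + i)) (\<lambda>j. w (q * k + j)))"
        unfolding sesq_compress
        by (intro sum.cong refl sesq_cong) (auto simp: entry_def block_of_def w_def)
      also have "\<dots> = sesq (m * k) (entry P) w w" by (rule sesq_mult_index[symmetric])
      finally show ?thesis using P psd_iff[OF Pc] by simp
    qed
    then show ?thesis using psd_iff[OF Ac] by blast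
  qed
  with lin show ?thesis unfolding completely_positive_def by blast
qed

text \<open>The hypothesis says that the columns of \<open>V\<close> are orthonormal.\<close>

lemma ucp_compression:
  assumes "\<And>a c. a < n \<Longrightarrow> c < n \<Longrightarrow> compress k unitf V a c = unitf a c"
  shows "ucp k n (compression k n V)"
proof -
  have "compress k (entry (1\<^sub>m k)) V a c = compress k unitf V a c" for a c
    unfolding compress_def by (intro sesq_cong) (auto simp: entry_def unitf_def)
  then have "compression k n V (1\<^sub>m k) = 1\<^sub>m n"
    using assms by (intro eq_matI) (auto simp: compression_def unitf_def)
  then show ?thesis using completely_positive_compression by (simp add: ucp_def)
qed

section \<open>The cone of compressions of a matrix convex set\<close>

lemma entry_mat_adjoint:
  assumes "A \<in> carrier_mat n n" "i < n" "j < n"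
  shows "entry (mat_adjoint A) i j = cnj (entry A j i)"
  using assms by (simp add: mat_adjoint_def mat_of_rows_def entry_def)

lemma sa_tuplesD:
  assumes "X \<in> sa_tuples d k"
  shows "length X = d" "\<And>i. i < d \<Longrightarrow> X ! i \<in> carrier_mat k k" "\<And>i. i < d \<Longrightarrow> mat_adjoint (X ! i) = X ! i"
  using assms by (auto simp: sa_tuples_def)

lemma herm_coord:
  assumes "X \<in> sa_tuples d k" "j \<le> d"
  shows "herm k (coord X j)"
proof (cases j)
  case (Suc i)
  then have "i < d" using assms by simp
  have "entry (X ! i) a c = cnj (entry (X ! i) c a)" if "a < k" "c < k" for a c
    using entry_mat_adjoint[OF sa_tuplesD(2)[OF assms(1) \<open>i < d\<close>] that]
    unfolding sa_tuplesD(3)[OF assms(1) \<open>i < d\<close>] .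
  then show ?thesis unfolding herm_def coord_def Suc nat.case by blast
qed (simp add: coord_def)

text \<open>Membership constrains only the components up to \<open>d\<close> and the entries below
  \<open>n\<close>, which makes the set insensitive to the junk values of its elements.\<close>

definition compression_cone :: "nat \<Rightarrow> nat \<Rightarrow> complex mat list set \<Rightarrow> (nat \<Rightarrow> nat \<Rightarrow> nat \<Rightarrow> complex) set" where
  "compression_cone d n S = {g. \<exists>k X V. 1 \<le> k \<and> X \<in> S \<inter> sa_tuples d k \<and>
     (\<forall>j\<le>d. \<forall>a<n. \<forall>c<n. g j a c = compress k (coord X j) V a c)}"

lemma compression_coneI:
  assumes "1 \<le> k" "X \<in> S" "X \<in> sa_tuples d k"
    "\<And>j a c. j \<le> d \<Longrightarrow> a < n \<Longrightarrow> c < n \<Longrightarrow> g j a c = compress k (coord X j) V a c"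
  shows "g \<in> compression_cone d n S"
  using assms unfolding compression_cone_def by blast

lemma compression_coneE:
  assumes "g \<in> compression_cone d n S"
  obtains k X V where "1 \<le> k" "X \<in> S" "X \<in> sa_tuples d k"
    "\<And>j a c. j \<le> d \<Longrightarrow> a < n \<Longrightarrow> c < n \<Longrightarrow> g j a c = compress k (coord X j) V a c"
  using assms unfolding compression_cone_def by blast

lemma sesq_block:
  assumes "\<And>i j. i < k \<Longrightarrow> j < k \<Longrightarrow> Z i j = X i j"
    "\<And>i j. i < l \<Longrightarrow> j < l \<Longrightarrow> Z (k + i) (k + j) = Y i j"
    "\<And>i j. i < k \<Longrightarrow> j < l \<Longrightarrow> Z i (k + j) = 0" "\<And>i j. i < l \<Longrightarrow> j < k \<Longrightarrow> Z (k + i) j = 0"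
  shows "sesq (k + l) Z u v = sesq k X u v + sesq l Y (\<lambda>i. u (k + i)) (\<lambda>i. v (k + i))"
proof -
  have split: "(\<Sum>i<k + l. f i) = (\<Sum>i<k. f i) + (\<Sum>i<l. f (k + i))" for f :: "nat \<Rightarrow> complex"
    by (induction l) (auto simp: add.assoc)
  show ?thesis unfolding sesq_def split
    using assms by (simp add: sum.distrib)
qed

lemma direct_sum_level:
  assumes "1 \<le> d" "matrix_convex d S" "X \<in> S" "Y \<in> S" "X \<in> sa_tuples d k" "Y \<in> sa_tuples d l"
  shows "tuple_direct_sum X Y \<in> S" "tuple_direct_sum X Y \<in> sa_tuples d (k + l)"
proof -
  show in_S: "tuple_direct_sum X Y \<in> S" using assms unfolding matrix_convex_def by blast
  then obtain m where m: "tuple_direct_sum X Y \<in> sa_tuples d m"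
    using assms(2) unfolding matrix_convex_def all_sa_tuples_def by blast
  have "tuple_direct_sum X Y ! 0 \<in> carrier_mat (k + l) (k + l)"
    using assms sa_tuplesD[OF assms(5)] sa_tuplesD[OF assms(6)]
    by (auto simp: tuple_direct_sum_def)
  moreover have "tuple_direct_sum X Y ! 0 \<in> carrier_mat m m" using sa_tuplesD(2)[OF m] assms(1) by simp
  ultimately have "m = k + l" by auto
  then show "tuple_direct_sum X Y \<in> sa_tuples d (k + l)" using m by simp
qed

text \<open>Stack the two matrices \<open>V\<close> and \<open>W\<close> and compress the direct
  sum.\<close>

lemma compression_cone_add:
  assumes "1 \<le> d" "matrix_convex d S" "g \<in> compression_cone d n S" "h \<in> compression_cone d n S"
  shows "(\<lambda>j a c. g j a c + h j a c) \<in> compression_cone d n S"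
proof -
  obtain k X V where X: "1 \<le> k" "X \<in> S" "X \<in> sa_tuples d k"
    "\<And>j a c. j \<le> d \<Longrightarrow> a < n \<Longrightarrow> c < n \<Longrightarrow> g j a c = compress k (coord X j) V a c"
    using compression_coneE[OF assms(3)] by blast
  obtain l Y W where Y: "1 \<le> l" "Y \<in> S" "Y \<in> sa_tuples d l"
    "\<And>j a c. j \<le> d \<Longrightarrow> a < n \<Longrightarrow> c < n \<Longrightarrow> h j a c = compress l (coord Y j) W a c"
    using compression_coneE[OF assms(4)] by blast
  let ?Z = "tuple_direct_sum X Y"
  define U where "U = (\<lambda>a i. if i < k then V a i else W a (i - k))"
  have "compress (k + l) (coord ?Z j) U a c = compress k (coord X j) V a c + compress l (coord Y j) W a c"
    if "j \<le> d" for j a c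
  proof -
    have "sesq (k + l) (coord ?Z j) (U a) (U c)
        = sesq k (coord X j) (U a) (U c) + sesq l (coord Y j) (\<lambda>i. U a (k + i)) (\<lambda>i. U c (k + i))"
    proof (cases j)
      case 0
      show ?thesis unfolding 0 coord_def by (rule sesq_block) (auto simp: unitf_def)
    next
      case (Suc i)
      then have i: "i < d" using that by simp
      have c: "X ! i \<in> carrier_mat k k" "Y ! i \<in> carrier_mat l l"
        using sa_tuplesD(2)[OF X(3) i] sa_tuplesD(2)[OF Y(3) i] .
      have "?Z ! i = four_block_mat (X ! i) (0\<^sub>m k l) (0\<^sub>m l k) (Y ! i)"
        using i c sa_tuplesD(1)[OF X(3)] sa_tuplesD(1)[OF Y(3)] by (simp add: tuple_direct_sum_def)
      then show ?thesis using c unfolding Suc coord_def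
        by (simp only: nat.case, intro sesq_block) (auto simp: entry_def)
    qed
    also have "\<dots> = sesq k (coord X j) (V a) (V c) + sesq l (coord Y j) (W a) (W c)"
      by (intro arg_cong2[of _ _ _ _ "(+)"] sesq_cong) (auto simp: U_def)
    finally show ?thesis by (simp add: compress_def)
  qed
  then show ?thesis
    using X Y direct_sum_level[OF assms(1,2) X(2) Y(2) X(3) Y(3)]
    by (intro compression_coneI[of "k + l" ?Z _ _ _ _ U]) auto
qed

lemma compression_cone_scale:
  assumes "g \<in> compression_cone d n S" "0 \<le> t"
  shows "(\<lambda>j a c. of_real t * g j a c) \<in> compression_cone d n S"
proof -
  obtain k X V where X: "1 \<le> k" "X \<in> S" "X \<in> sa_tuples d k"
    "\<And>j a c. j \<le> d \<Longrightarrow> a < n \<Longrightarrow> c < n \<Longrightarrow> g j a c = compress k (coord X j) V a c"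
    using compression_coneE[OF assms(1)] by blast
  have "complex_of_real (sqrt t) * of_real (sqrt t) = of_real t"
    using assms(2) by (simp flip: of_real_mult)
  then have "compress k Z (\<lambda>a i. of_real (sqrt t) * V a i) a c = of_real t * compress k Z V a c" for Z a c
    by (simp add: compress_def sesq_scale_vec mult.assoc[symmetric])
  then show ?thesis using X by (intro compression_coneI[of k X _ _ _ _ "\<lambda>a i. of_real (sqrt t) * V a i"]) auto
qed

lemma compression_cone_zero:
  assumes "1 \<le> k" "X \<in> S" "X \<in> sa_tuples d k"
  shows "(\<lambda>j a c. 0) \<in> compression_cone d n S"
  using assms by (intro compression_coneI[of k X _ _ _ _ "\<lambda>a i. 0"]) (auto simp: compress_def sesq_def)

text \<open>A rank-one first component is obtained from any element of S by a matrix with one nonzero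
  row; the general case is a sum of these.\<close>

lemma compression_cone_first_component:
  assumes "1 \<le> d" "matrix_convex d S" "S \<noteq> {}" "pos_semidef n Q"
  obtains g where "g \<in> compression_cone d n S" "\<And>a c. a < n \<Longrightarrow> c < n \<Longrightarrow> g 0 a c = Q a c"
proof -
  obtain X where "X \<in> S" using assms(3) by blast
  moreover have "X \<in> all_sa_tuples d" using assms(2) \<open>X \<in> S\<close> unfolding matrix_convex_def by blast
  ultimately obtain k where X: "1 \<le> k" "X \<in> S" "X \<in> sa_tuples d k"
    unfolding all_sa_tuples_def by auto
  obtain T where T: "\<And>a c. a < n \<Longrightarrow> c < n \<Longrightarrow> Q a c = (\<Sum>e<n. T e a * cnj (T e c))"
    using cholesky[OF assms(4)] by blast
  have "\<exists>g\<in>compression_cone d n S. \<forall>a<n. \<forall>c<n. g 0 a c = (\<Sum>e<m. T e a * cnj (T e c))" for m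
  proof (induction m)
    case 0
    show ?case using compression_cone_zero[OF X] by (intro bexI[of _ "\<lambda>j a c. 0"]) auto
  next
    case (Suc m)
    then obtain g where g: "g \<in> compression_cone d n S" "\<forall>a<n. \<forall>c<n. g 0 a c = (\<Sum>e<m. T e a * cnj (T e c))"
      by blast
    define V where "V = (\<lambda>a i. if i = (0::nat) then cnj (T m a) else 0)"
    define h where "h = (\<lambda>j. compress k (coord X j) V)"
    have h: "h \<in> compression_cone d n S" using X by (intro compression_coneI[of k X _ _ _ _ V]) (auto simp: h_def)
    have "h 0 a c = T m a * cnj (T m c)" for a c
    proof -
      have "h 0 a c = (\<Sum>i<k. cnj (V a i) * V c i)" by (simp add: h_def coord_def compress_def sesq_unit)
      also have "\<dots> = (\<Sum>i<k. if i = 0 then T m a * cnj (T m c) else 0)"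
        by (intro sum.cong refl) (auto simp: V_def)
      finally show ?thesis using X(1) by simp
    qed
    then show ?case using g(2) by (intro bexI[OF _ compression_cone_add[OF assms(1,2) g(1) h]]) auto
  qed
  from this[of n] T that show thesis by fastforce
qed

text \<open>Over the identity \<open>V\<close> is an isometry, so the compression is UCP and stays in
  S.\<close>

lemma compression_cone_unit:
  assumes "1 \<le> d" "1 \<le> n" "matrix_convex d S" "g \<in> compression_cone d n S"
    and unit: "\<And>a c. a < n \<Longrightarrow> c < n \<Longrightarrow> g 0 a c = unitf a c"
  obtains Z where "Z \<in> S" "Z \<in> sa_tuples d n"
    "\<And>j a c. j \<le> d \<Longrightarrow> a < n \<Longrightarrow> c < n \<Longrightarrow> g j a c = coord Z j a c"
proof -
  obtain k X V where X: "1 \<le> k" "X \<in> S" "X \<in> sa_tuples d k"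
    "\<And>j a c. j \<le> d \<Longrightarrow> a < n \<Longrightarrow> c < n \<Longrightarrow> g j a c = compress k (coord X j) V a c"
    using compression_coneE[OF assms(4)] by blast
  have "ucp k n (compression k n V)"
    using X(4)[of 0] unit by (intro ucp_compression) (simp add: coord_def)
  let ?Z = "map (compression k n V) X"
  have Z: "?Z \<in> S" using assms(2,3) X(1-3) \<open>ucp k n _\<close> unfolding matrix_convex_def by blast
  then obtain m where m: "?Z \<in> sa_tuples d m"
    using assms(3) unfolding matrix_convex_def all_sa_tuples_def by blast
  have len: "length X = d" using sa_tuplesD(1)[OF X(3)] .
  have "?Z ! 0 \<in> carrier_mat n n" using assms(1) len by (simp add: compression_def)
  moreover have "?Z ! 0 \<in> carrier_mat m m" using sa_tuplesD(2)[OF m, of 0] assms(1) by simp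
  ultimately have "m = n" by auto
  have "g j a c = coord ?Z j a c" if "j \<le> d" "a < n" "c < n" for j a c
  proof (cases j)
    case 0
    then show ?thesis using unit that by (simp add: coord_def)
  next
    case (Suc i)
    then show ?thesis using X(4)[OF that] that len by (simp add: coord_def entry_def compression_def)
  qed
  then show thesis using that[OF Z] m \<open>m = n\<close> by blast
qed

text \<open>The index \<open>j = 0\<close> is included for uniformity; it forces \<open>1 \<le> R\<close>
  as soon as S has an element of positive level.\<close>

definition level_bounded :: "nat \<Rightarrow> real \<Rightarrow> complex mat list set \<Rightarrow> bool" where
  "level_bounded d R S \<longleftrightarrow> (\<forall>k. \<forall>X \<in> S \<inter> sa_tuples d k. \<forall>j\<le>d. \<forall>u.
     \<bar>qform k (coord X j) u\<bar> \<le> R * sqnorm k u)"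

lemma qform_compression_cone:
  assumes "g \<in> compression_cone d n S" "level_bounded d R S" "j \<le> d"
  shows "herm n (g j)" "\<bar>qform n (g j) u\<bar> \<le> R * qform n (g 0) u"
proof -
  obtain k X V where X: "1 \<le> k" "X \<in> S" "X \<in> sa_tuples d k"
    "\<And>j a c. j \<le> d \<Longrightarrow> a < n \<Longrightarrow> c < n \<Longrightarrow> g j a c = compress k (coord X j) V a c"
    using compression_coneE[OF assms(1)] by blast
  have "herm n (compress k (coord X j) V)" using herm_compress herm_coord[OF X(3) assms(3)] by blast
  then show "herm n (g j)" using herm_cong[of n "g j"] X(4)[OF assms(3)] by blast
  have q: "qform n (g i) u = qform k (coord X i) (\<lambda>m. \<Sum>a<n. u a * V a m)" if "i \<le> d" for i
    unfolding qform_compress[symmetric] using X(4)[OF that] by (intro qform_cong) auto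
  show "\<bar>qform n (g j) u\<bar> \<le> R * qform n (g 0) u"
    using assms(2) X(2,3) assms(3) unfolding q[OF assms(3)] q[OF le0] level_bounded_def coord_def[of X 0]
    by simp
qed

lemma compression_cone_pos:
  assumes "g \<in> compression_cone d n S" "level_bounded d R S" "j \<le> d"
  shows "pos_semidef n (\<lambda>a c. of_real R * g 0 a c + g j a c)" "pos_semidef n (\<lambda>a c. of_real R * g 0 a c - g j a c)"
proof -
  have "0 \<le> R * qform n (g 0) u + qform n (g j) u" "0 \<le> R * qform n (g 0) u - qform n (g j) u" for u
    using qform_compression_cone(2)[OF assms, of u] by linarith+
  moreover have "herm n (g 0)" "herm n (g j)" using qform_compression_cone(1)[OF assms(1,2)] assms(3) by auto
  ultimately show "pos_semidef n (\<lambda>a c. of_real R * g 0 a c + g j a c)" "pos_semidef n (\<lambda>a c. of_real R * g 0 a c - g j a c)"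
    unfolding pos_semidef_def by (simp_all add: herm_add herm_diff herm_scale)
qed

text \<open>The first component \<open>P\<close> of \<open>g\<close> satisfies \<open>1 - 2e \<le> P
  \<le> 1 + 2e\<close>.  Scaling by \<open>c = 1 / (1 + 2e)\<close> brings it below 1, and the defect
  \<open>1 - cP \<le> 4e\<close> is the first component of an element \<open>h\<close> of the cone, whose
  other components are then at most \<open>4Re\<close>.  The sum \<open>cg + h\<close> lies over the
  identity.  A square root of \<open>P\<close> is thereby avoided, and so is any dependence of the
  constants on \<open>n\<close>.\<close>

lemma compression_cone_near_gives_near_element:
  assumes "1 \<le> d" "1 \<le> n" "matrix_convex d S" "S \<noteq> {}" "level_bounded d R S" "1 \<le> R" "0 < e"
    and g: "g \<in> compression_cone d n S"
    and close: "\<And>j u. j \<le> d \<Longrightarrow> \<bar>qform n (coord A j) u - qform n (g j) u\<bar> \<le> 2 * e * sqnorm n u"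
  obtains Z where "Z \<in> S" "Z \<in> sa_tuples d n"
    "\<And>j u. j \<le> d \<Longrightarrow> \<bar>qform n (coord A j) u - qform n (coord Z j) u\<bar> \<le> (2 + 6 * R) * e * sqnorm n u"
proof -
  define c where "c = 1 / (1 + 2 * e)"
  have c: "0 < c" "c \<le> 1" "c * (1 + 2 * e) = 1" using \<open>0 < e\<close> by (auto simp: c_def)
  have P: "(1 - 2 * e) * sqnorm n u \<le> qform n (g 0) u" "qform n (g 0) u \<le> (1 + 2 * e) * sqnorm n u" for u
    using close[of 0 u] by (auto simp: coord_def algebra_simps)
  define Q where "Q = (\<lambda>a b. unitf a b - of_real c * g 0 a b)"
  have qQ: "qform n Q u = sqnorm n u - c * qform n (g 0) u" for u by (simp add: Q_def)
  have cP: "c * qform n (g 0) u \<le> sqnorm n u" for u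
    using mult_left_mono[OF P(2)[of u], of c] c by (simp add: mult.assoc[symmetric])
  have "pos_semidef n Q" unfolding pos_semidef_def
  proof (intro conjI allI)
    show "herm n Q" unfolding Q_def using qform_compression_cone(1)[OF g assms(5), of 0]
      by (intro herm_diff herm_scale herm_unit) auto
    show "0 \<le> qform n Q u" for u using cP[of u] by (simp add: qQ)
  qed
  then obtain h where h: "h \<in> compression_cone d n S" "\<And>a b. a < n \<Longrightarrow> b < n \<Longrightarrow> h 0 a b = Q a b"
    using compression_cone_first_component[OF assms(1,3,4)] by blast
  let ?G = "\<lambda>j a b. of_real c * g j a b + h j a b"
  have "?G \<in> compression_cone d n S" using c by (intro compression_cone_add compression_cone_scale g h(1) assms) auto
  then obtain Z where Z: "Z \<in> S" "Z \<in> sa_tuples d n"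
    "\<And>j a b. j \<le> d \<Longrightarrow> a < n \<Longrightarrow> b < n \<Longrightarrow> ?G j a b = coord Z j a b"
    using compression_cone_unit[OF assms(1,2,3), of ?G] h(2) by (auto simp: Q_def)
  have "\<bar>qform n (coord A j) u - qform n (coord Z j) u\<bar> \<le> (2 + 6 * R) * e * sqnorm n u" if j: "j \<le> d" for j u
  proof -
    have "qform n (coord Z j) u = qform n (?G j) u" using Z(3)[OF j] by (intro qform_cong) auto
    then have z: "qform n (coord Z j) u = c * qform n (g j) u + qform n (h j) u" by simp
    have s: "0 \<le> sqnorm n u" by simp
    have "qform n (h 0) u = qform n Q u" using h(2) by (intro qform_cong) auto
    then have "\<bar>qform n (h j) u\<bar> \<le> R * (sqnorm n u - c * qform n (g 0) u)"
      using qform_compression_cone(2)[OF h(1) assms(5) j, of u] by (simp add: qQ)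
    also have "\<dots> \<le> R * (4 * e * sqnorm n u)"
    proof (rule mult_left_mono)
      have "c * ((1 - 2 * e) * sqnorm n u) \<le> c * qform n (g 0) u" using P(1) c by (intro mult_left_mono) auto
      moreover have "c * ((1 - 2 * e) * sqnorm n u) = sqnorm n u - c * (4 * e * sqnorm n u)"
      proof -
        have "c * ((1 - 2 * e) * sqnorm n u) = c * (1 + 2 * e) * sqnorm n u - c * (4 * e * sqnorm n u)"
          by (simp add: algebra_simps)
        then show ?thesis by (simp add: c(3))
      qed
      moreover have "c * (4 * e * sqnorm n u) \<le> 4 * e * sqnorm n u"
        using c s \<open>0 < e\<close> by (intro mult_left_le_one_le) auto
      ultimately show "sqnorm n u - c * qform n (g 0) u \<le> 4 * e * sqnorm n u" by linarith
    qed (use assms in auto)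
    finally have h': "\<bar>qform n (h j) u\<bar> \<le> 4 * R * e * sqnorm n u" by (simp add: mult.assoc mult.left_commute)
    have "\<bar>(1 - c) * qform n (g j) u\<bar> \<le> (1 - c) * (R * qform n (g 0) u)"
      using qform_compression_cone(2)[OF g assms(5) j, of u] c by (simp add: abs_mult mult_left_mono)
    also have "\<dots> = 2 * e * R * (c * qform n (g 0) u)"
    proof -
      have "1 - c = c * (2 * e)" using c(3) by (simp add: algebra_simps)
      then show ?thesis by simp
    qed
    also have "\<dots> \<le> 2 * e * R * sqnorm n u" using cP assms by (intro mult_left_mono) auto
    finally have g': "\<bar>(1 - c) * qform n (g j) u\<bar> \<le> 2 * R * e * sqnorm n u" by (simp add: mult.assoc mult.left_commute)
    have "qform n (coord A j) u - qform n (coord Z j) u =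
       (qform n (coord A j) u - qform n (g j) u) + (1 - c) * qform n (g j) u - qform n (h j) u"
      unfolding z by (simp add: algebra_simps)
    then have "\<bar>qform n (coord A j) u - qform n (coord Z j) u\<bar>
        \<le> 2 * e * sqnorm n u + 2 * R * e * sqnorm n u + 4 * R * e * sqnorm n u"
      using close[OF j, of u] g' h' by linarith
    then show ?thesis by (simp add: algebra_simps)
  qed
  then show thesis using that Z by blast
qed

section \<open>A functional separating a tuple from the cone\<close>

lemma qform_entries_small:
  assumes "\<And>a c. a < n \<Longrightarrow> c < n \<Longrightarrow> cmod (X a c) \<le> r"
  shows "\<bar>qform n X u\<bar> \<le> real n * r * sqnorm n u"
proof -
  have "\<bar>qform n X u\<bar> \<le> cmod (sesq n X u u)" unfolding qform_def by (rule abs_Re_le_cmod)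
  also have "\<dots> \<le> (\<Sum>i<n. \<Sum>j<n. cmod (cnj (u i) * X i j * u j))"
    unfolding sesq_def by (intro order.trans[OF norm_sum] sum_mono norm_sum)
  also have "\<dots> \<le> (\<Sum>i<n. \<Sum>j<n. r * (((cmod (u i))\<^sup>2 + (cmod (u j))\<^sup>2) / 2))"
  proof (intro sum_mono)
    fix i j assume ij: "i \<in> {..<n}" "j \<in> {..<n}"
    have X: "cmod (X i j) \<le> r" using assms ij by simp
    have "cmod (cnj (u i) * X i j * u j) = cmod (X i j) * (cmod (u i) * cmod (u j))"
      by (simp add: norm_mult)
    also have "\<dots> \<le> r * (((cmod (u i))\<^sup>2 + (cmod (u j))\<^sup>2) / 2)"
      using X sum_squares_bound[of "cmod (u i)" "cmod (u j)"] order.trans[OF norm_ge_zero X]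
      by (intro mult_mono) auto
    finally show "cmod (cnj (u i) * X i j * u j) \<le> r * (((cmod (u i))\<^sup>2 + (cmod (u j))\<^sup>2) / 2)" .
  qed
  also have "\<dots> = real n * r * sqnorm n u"
    by (simp add: sum_distrib_left[symmetric] sum.distrib sum_divide_distrib[symmetric] sqnorm_def[symmetric] algebra_simps)
  finally show ?thesis .
qed

lemma sum_triple_pairing:
  "(\<Sum>i\<in>{..m} \<times> {..<n} \<times> {..<n}. Re (cnj (y i - x i) * z i))
   = (\<Sum>j\<le>m. pairing n (\<lambda>a c. cnj (y (j, a, c) - x (j, a, c))) (\<lambda>a c. z (j, a, c)))"
proof -
  have "(\<Sum>i\<in>{..m} \<times> {..<n} \<times> {..<n}. Re (cnj (y i - x i) * z i))
    = (\<Sum>j\<le>m. \<Sum>a<n. \<Sum>c<n. Re (cnj (y (j, a, c) - x (j, a, c)) * z (j, a, c)))"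
    unfolding sum.cartesian_product by (intro sum.cong refl) auto
  then show ?thesis unfolding pairing_def Re_sum .
qed

lemma pos_semidef_rank_one: "pos_semidef n (\<lambda>a c. cnj (u a) * u c)"
  unfolding pos_semidef_def
proof (intro conjI allI)
  show "herm n (\<lambda>a c. cnj (u a) * u c)" by (simp add: herm_def mult.commute)
  fix v
  have "sesq n (\<lambda>a c. cnj (u a) * u c) v v = cnj (\<Sum>a<n. u a * v a) * (\<Sum>c<n. u c * v c)"
    unfolding sesq_def cnj_sum sum_product by (intro sum.cong refl) (simp add: algebra_simps)
  also have "\<dots> = of_real ((cmod (\<Sum>a<n. u a * v a))\<^sup>2)"
    unfolding complex_norm_square by (rule mult.commute)
  finally show "0 \<le> qform n (\<lambda>a c. cnj (u a) * u c) v" by (simp add: qform_def)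
qed

text \<open>The cone \<open>K\<close> below has an additional matrix component that dominates the
  deviation of the others from C.  Testing with \<open>(\<plusminus>E e\<^sub>j, E)\<close> for rank-one
  \<open>E\<close> gives the two inequalities between \<open>w\<close> and \<open>f\<^sub>j\<close>,
  testing with \<open>(g, 0)\<close> gives nonnegativity on C.  Both hold first up to an error of
  \<open>\<kappa>\<close> times a trace; adding multiples of \<open>\<kappa> 1\<close> to
  \<open>f\<^sub>0\<close> and \<open>w\<close> absorbs it and makes \<open>w\<close> definite at the
  same time.\<close>

lemma separating_functional:
  fixes A :: "complex mat list"
  assumes "1 \<le> d" "1 \<le> n" "matrix_convex d S" "S \<noteq> {}" "level_bounded d R S" "1 \<le> R" "0 < e"
    and A: "A \<in> sa_tuples d n"
    and far: "\<And>g. g \<in> compression_cone d n S \<Longrightarrow>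
      \<exists>j\<le>d. \<exists>u. 2 * e * sqnorm n u < \<bar>qform n (coord A j) u - qform n (g j) u\<bar>"
  obtains f w where
    "\<And>j. j \<le> d \<Longrightarrow> pos_semidef n (\<lambda>a c. w a c + f j a c)" "\<And>j. j \<le> d \<Longrightarrow> pos_semidef n (\<lambda>a c. w a c - f j a c)"
    "\<And>u. sqnorm n u \<noteq> 0 \<Longrightarrow> 0 < qform n w u"
    "\<And>g. g \<in> compression_cone d n S \<Longrightarrow> 0 \<le> (\<Sum>j\<le>d. pairing n (f j) (g j))"
    "(\<Sum>j\<le>d. pairing n (f j) (coord A j)) + e * pairing n w unitf \<le> 0"
proof -
  let ?I = "{..Suc d} \<times> {..<n} \<times> {..<n}"
  \<comment> \<open>The Euclidean distance \<open>r\<close> may depend on \<open>n\<close>: entries of size \<open>r\<close> change a form by at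
    most \<open>e / 2\<close>.  Then \<open>\<eta>\<close> is chosen such that all error terms at \<open>(1, A, e 1)\<close> add up to at
    most \<open>r\<^sup>2\<close>, the amount by which the approximate functional is negative there.\<close>
  define r where "r = e / (2 * real n)"
  have r: "0 < r" "real n * r = e / 2" using assms by (auto simp: r_def)
  define N where "N = real (card ?I)"
  have "0 < card ?I" unfolding card_gt_0_iff using assms(2) by (auto simp: lessThan_empty_iff)
  then have N: "1 \<le> N" unfolding N_def by linarith
  define C where "C = 1 + N * R * real n * (1 + 3 * e)"
  have C: "0 < C" using N assms by (simp add: C_def add_pos_nonneg)
  define \<eta> where "\<eta> = r\<^sup>2 / C"
  have eta: "0 < \<eta>" "\<eta> * C = r\<^sup>2" using r C by (auto simp: \<eta>_def)
  define \<kappa> where "\<kappa> = \<eta> * N * R"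
  have kappa: "0 < \<kappa>" using eta N assms by (simp add: \<kappa>_def)
  define x where "x = (\<lambda>(j, a, c). if j = Suc d then of_real e * unitf a c else coord A j a c)"
  define K where "K = {y. \<exists>h \<in> compression_cone d n S. \<forall>j\<le>d.
    pos_semidef n (\<lambda>a c. y (Suc d, a, c) + (y (j, a, c) - h j a c)) \<and>
    pos_semidef n (\<lambda>a c. y (Suc d, a, c) - (y (j, a, c) - h j a c))}"
  obtain X where "X \<in> S" using assms(4) by blast
  moreover have "X \<in> all_sa_tuples d" using assms(3) \<open>X \<in> S\<close> unfolding matrix_convex_def by blast
  ultimately have zero: "(\<lambda>j a c. 0) \<in> compression_cone d n S"
    unfolding all_sa_tuples_def using compression_cone_zero by fastforce
  have pos_semidef_0: "pos_semidef n (\<lambda>a c. 0)" by (simp add: pos_semidef_def herm_def qform_def sesq_def)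
  have K0: "(\<lambda>i. 0) \<in> K" unfolding K_def using zero pos_semidef_0 by (auto intro!: bexI[of _ "\<lambda>j a c. 0"])
  have K_add: "(\<lambda>i. y i + z i) \<in> K" if yz: "y \<in> K" "z \<in> K" for y z
  proof -
    obtain h where h: "h \<in> compression_cone d n S"
      "\<And>j. j \<le> d \<Longrightarrow> pos_semidef n (\<lambda>a c. y (Suc d, a, c) + (y (j, a, c) - h j a c))"
      "\<And>j. j \<le> d \<Longrightarrow> pos_semidef n (\<lambda>a c. y (Suc d, a, c) - (y (j, a, c) - h j a c))"
      using yz(1) unfolding K_def by blast
    obtain k where k: "k \<in> compression_cone d n S"
      "\<And>j. j \<le> d \<Longrightarrow> pos_semidef n (\<lambda>a c. z (Suc d, a, c) + (z (j, a, c) - k j a c))"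
      "\<And>j. j \<le> d \<Longrightarrow> pos_semidef n (\<lambda>a c. z (Suc d, a, c) - (z (j, a, c) - k j a c))"
      using yz(2) unfolding K_def by blast
    show ?thesis unfolding K_def
    proof (intro CollectI bexI[OF _ compression_cone_add[OF assms(1,3) h(1) k(1)]] allI impI conjI)
      fix j assume "j \<le> d"
      from pos_semidef_add[OF h(2)[OF this] k(2)[OF this]] pos_semidef_add[OF h(3)[OF this] k(3)[OF this]]
      show "pos_semidef n (\<lambda>a c. y (Suc d, a, c) + z (Suc d, a, c) + (y (j, a, c) + z (j, a, c) - (h j a c + k j a c)))"
        "pos_semidef n (\<lambda>a c. y (Suc d, a, c) + z (Suc d, a, c) - (y (j, a, c) + z (j, a, c) - (h j a c + k j a c)))"
        by (simp_all add: algebra_simps)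
    qed
  qed
  have K_scale: "(\<lambda>i. of_real t * y i) \<in> K" if yt: "y \<in> K" "0 \<le> t" for y t
  proof -
    obtain h where h: "h \<in> compression_cone d n S"
      "\<And>j. j \<le> d \<Longrightarrow> pos_semidef n (\<lambda>a c. y (Suc d, a, c) + (y (j, a, c) - h j a c))"
      "\<And>j. j \<le> d \<Longrightarrow> pos_semidef n (\<lambda>a c. y (Suc d, a, c) - (y (j, a, c) - h j a c))"
      using yt(1) unfolding K_def by blast
    show ?thesis unfolding K_def
    proof (intro CollectI bexI[OF _ compression_cone_scale[OF h(1) yt(2)]] allI impI conjI)
      fix j assume "j \<le> d"
      from pos_semidef_scale[OF h(2)[OF this] yt(2)] pos_semidef_scale[OF h(3)[OF this] yt(2)]
      show "pos_semidef n (\<lambda>a c. of_real t * y (Suc d, a, c) + (of_real t * y (j, a, c) - of_real t * h j a c))"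
        "pos_semidef n (\<lambda>a c. of_real t * y (Suc d, a, c) - (of_real t * y (j, a, c) - of_real t * h j a c))"
        by (simp_all add: algebra_simps)
    qed
  qed
  have dist: "r\<^sup>2 \<le> (\<Sum>i\<in>?I. (cmod (x i - y i))\<^sup>2)" if "y \<in> K" for y
  proof (rule ccontr)
    assume "\<not> ?thesis"
    then have less: "(\<Sum>i\<in>?I. (cmod (x i - y i))\<^sup>2) < r\<^sup>2" by simp
    obtain h where h: "h \<in> compression_cone d n S"
      "\<And>j. j \<le> d \<Longrightarrow> pos_semidef n (\<lambda>a c. y (Suc d, a, c) + (y (j, a, c) - h j a c))"
      "\<And>j. j \<le> d \<Longrightarrow> pos_semidef n (\<lambda>a c. y (Suc d, a, c) - (y (j, a, c) - h j a c))"
      using \<open>y \<in> K\<close> unfolding K_def by blast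
    have entry: "cmod (x (j, a, c) - y (j, a, c)) \<le> r" if "j \<le> Suc d" "a < n" "c < n" for j a c
    proof -
      have "(cmod (x (j, a, c) - y (j, a, c)))\<^sup>2 \<le> (\<Sum>i\<in>?I. (cmod (x i - y i))\<^sup>2)"
        using that by (intro member_le_sum[of "(j, a, c)" ?I "\<lambda>i. (cmod (x i - y i))\<^sup>2"]) auto
      with less have "(cmod (x (j, a, c) - y (j, a, c)))\<^sup>2 \<le> r\<^sup>2" by linarith
      then show ?thesis using r(1) by (rule power2_le_imp_le[OF _ less_imp_le])
    qed
    have close: "\<bar>qform n (\<lambda>a c. x (j, a, c)) u - qform n (\<lambda>a c. y (j, a, c)) u\<bar> \<le> e / 2 * sqnorm n u"
      if "j \<le> Suc d" for j u
      using qform_entries_small[of n "\<lambda>a c. x (j, a, c) - y (j, a, c)" r u] entry[OF that] r(2) by simp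
    obtain j u where ju: "j \<le> d" "2 * e * sqnorm n u < \<bar>qform n (coord A j) u - qform n (h j) u\<bar>"
      using far[OF h(1)] by blast
    have xj: "(\<lambda>a c. x (j, a, c)) = coord A j" "(\<lambda>a c. x (Suc d, a, c)) = (\<lambda>a c. of_real e * unitf a c)"
      using ju(1) by (auto simp: x_def)
    have "\<bar>qform n (coord A j) u - qform n (\<lambda>a c. y (j, a, c)) u\<bar> \<le> e / 2 * sqnorm n u"
      using close[of j u] ju(1) by (simp add: xj)
    moreover have "\<bar>e * sqnorm n u - qform n (\<lambda>a c. y (Suc d, a, c)) u\<bar> \<le> e / 2 * sqnorm n u"
      using close[of "Suc d" u] by (simp add: xj)
    moreover have "0 \<le> qform n (\<lambda>a c. y (Suc d, a, c)) u + (qform n (\<lambda>a c. y (j, a, c)) u - qform n (h j) u)"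
      "0 \<le> qform n (\<lambda>a c. y (Suc d, a, c)) u - (qform n (\<lambda>a c. y (j, a, c)) u - qform n (h j) u)"
      using h(2)[OF ju(1)] h(3)[OF ju(1)] by (simp_all add: pos_semidef_def)
    moreover have "2 * e * sqnorm n u = e * sqnorm n u + e / 2 * sqnorm n u + e / 2 * sqnorm n u" by (simp add: algebra_simps)
    ultimately show False using ju(2) by linarith
  qed
  obtain y where y: "y \<in> K"
    "\<And>z. z \<in> K \<Longrightarrow> - \<eta> * sqrt (\<Sum>i\<in>?I. (cmod (z i))\<^sup>2) \<le> (\<Sum>i\<in>?I. Re (cnj (y i - x i) * z i))"
    "(\<Sum>i\<in>?I. Re (cnj (y i - x i) * x i)) \<le> \<eta> - r\<^sup>2"
    by (rule cone_approximate_separation[where I = ?I and K = K and x = x and r = r and \<eta> = \<eta>,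
        OF _ K0 K_add K_scale dist eta(1)]) (simp | assumption | rule that; assumption)+
  define F where "F = (\<lambda>j a c. cnj (y (j, a, c) - x (j, a, c)))"
  have F: "- \<kappa> * b \<le> (\<Sum>j\<le>d. pairing n (F j) (\<lambda>a c. z (j, a, c))) + pairing n (F (Suc d)) (\<lambda>a c. z (Suc d, a, c))"
    if z: "z \<in> K" "\<And>j a c. j \<le> Suc d \<Longrightarrow> a < n \<Longrightarrow> c < n \<Longrightarrow> cmod (z (j, a, c)) \<le> R * b" "0 \<le> b" for z b
  proof -
    have "(\<Sum>i\<in>?I. (cmod (z i))\<^sup>2) \<le> (\<Sum>i\<in>?I. (R * b)\<^sup>2)"
      using z(2) by (intro sum_mono power_mono) auto
    also have "\<dots> = N * (R * b)\<^sup>2" by (simp add: N_def)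
    also have "\<dots> \<le> N * N * (R * b)\<^sup>2" using N by (intro mult_right_mono) auto
    also have "\<dots> = (N * (R * b))\<^sup>2" by (simp add: power2_eq_square)
    finally have "sqrt (\<Sum>i\<in>?I. (cmod (z i))\<^sup>2) \<le> N * (R * b)"
      using N assms z(3) by (intro real_le_lsqrt) (auto intro: sum_nonneg)
    then have "\<eta> * sqrt (\<Sum>i\<in>?I. (cmod (z i))\<^sup>2) \<le> \<kappa> * b"
      using eta(1) by (simp add: \<kappa>_def mult.assoc)
    then have "- \<kappa> * b \<le> (\<Sum>i\<in>?I. Re (cnj (y i - x i) * z i))" using y(2)[OF z(1)] by simp
    also have "\<dots> = (\<Sum>j\<le>Suc d. pairing n (F j) (\<lambda>a c. z (j, a, c)))"
      unfolding sum_triple_pairing F_def ..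
    finally show ?thesis by simp
  qed
  have Fx: "(\<Sum>j\<le>d. pairing n (F j) (coord A j)) + e * pairing n (F (Suc d)) unitf \<le> \<eta> - r\<^sup>2"
  proof -
    have "(\<Sum>j\<le>d. pairing n (F j) (coord A j)) = (\<Sum>j\<le>d. pairing n (F j) (\<lambda>a c. x (j, a, c)))"
      by (intro sum.cong refl pairing_cong) (auto simp: x_def)
    moreover have "e * pairing n (F (Suc d)) unitf = pairing n (F (Suc d)) (\<lambda>a c. x (Suc d, a, c))"
      by (simp add: x_def pairing_scale_right)
    ultimately show ?thesis using y(3) unfolding sum_triple_pairing F_def by simp
  qed
  have herm_y: "herm n (\<lambda>a c. y (j, a, c))" if "j \<le> Suc d" for j
  proof -
    obtain h where h: "h \<in> compression_cone d n S"
      "\<And>j. j \<le> d \<Longrightarrow> pos_semidef n (\<lambda>a c. y (Suc d, a, c) + (y (j, a, c) - h j a c))"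
      "\<And>j. j \<le> d \<Longrightarrow> pos_semidef n (\<lambda>a c. y (Suc d, a, c) - (y (j, a, c) - h j a c))"
      using y(1) unfolding K_def by blast
    have half: "herm n Y" if "herm n (\<lambda>a c. Y a c + D a c)" "herm n (\<lambda>a c. Y a c - D a c)" for Y D
      using herm_scale[OF herm_add[OF that], of "1/2"] by (simp add: field_simps)
    have top: "herm n (\<lambda>a c. y (Suc d, a, c))"
      using half[of "\<lambda>a c. y (Suc d, a, c)"] h(2)[of 0] h(3)[of 0] by (auto simp: pos_semidef_def)
    show ?thesis
    proof (cases "j = Suc d")
      case False
      then have j: "j \<le> d" using that by simp
      have "herm n (\<lambda>a c. (y (Suc d, a, c) + (y (j, a, c) - h j a c)) - y (Suc d, a, c) + h j a c)"
        using h(2)[OF j] top qform_compression_cone(1)[OF h(1) assms(5) j]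
        by (intro herm_add[of n "\<lambda>a c. (y (Suc d, a, c) + (y (j, a, c) - h j a c)) - y (Suc d, a, c)"] herm_diff)
          (auto simp: pos_semidef_def)
      then show ?thesis by simp
    qed (use top in simp)
  qed
  have herm_F: "herm n (F j)" if "j \<le> Suc d" for j
  proof -
    have "herm n (\<lambda>a c. x (j, a, c))"
      using herm_coord[OF A, of j] herm_scale[OF herm_unit[of n], of e] that
      by (cases "j = Suc d") (auto simp: x_def)
    then have "herm n (\<lambda>a c. y (j, a, c) - x (j, a, c))" using herm_diff herm_y[OF that] by blast
    then have "y (j, c, a) - x (j, c, a) = cnj (y (j, a, c) - x (j, a, c))" if "a < n" "c < n" for a c
      using hermD[OF _ that, of "\<lambda>a c. y (j, a, c) - x (j, a, c)"] by blast
    then show ?thesis unfolding herm_def F_def by (metis complex_cnj_cnj)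
  qed
  have test: "- \<kappa> * sqnorm n u \<le> qform n (F (Suc d)) u + s * qform n (F i) u"
    if "i \<le> d" "s = 1 \<or> s = -1" for i u s
  proof -
    let ?E = "\<lambda>a c. cnj (u a) * u c"
    define z where "z = (\<lambda>(j, a, c). if j = Suc d then ?E a c else if j = i then of_real s * ?E a c else 0)"
    have tr: "pairing n unitf ?E = sqnorm n u" by (simp add: pairing_rank_one)
    have "z \<in> K" unfolding K_def
    proof (intro CollectI bexI[OF _ zero] allI impI conjI)
      fix j assume "j \<le> d"
      have "pos_semidef n (\<lambda>a c. ?E a c + ?E a c)" using pos_semidef_add[OF pos_semidef_rank_one pos_semidef_rank_one] .
      then show "pos_semidef n (\<lambda>a c. z (Suc d, a, c) + (z (j, a, c) - 0))"
        "pos_semidef n (\<lambda>a c. z (Suc d, a, c) - (z (j, a, c) - 0))"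
        using that(2) \<open>j \<le> d\<close> pos_semidef_rank_one[of n u] pos_semidef_0 by (cases "j = i"; auto simp: z_def)+
    qed
    moreover have "cmod (z (j, a, c)) \<le> R * sqnorm n u" if ac: "a < n" "c < n" for j a c
    proof -
      have "cmod (?E a c) \<le> sqnorm n u" using pos_semidef_entry_le_trace[OF pos_semidef_rank_one ac, of u] by (simp add: tr)
      also have "\<dots> \<le> R * sqnorm n u" using assms(6) mult_right_mono[of 1 R "sqnorm n u"] by simp
      finally have "cmod (?E a c) \<le> R * sqnorm n u" .
      moreover have "0 \<le> R * sqnorm n u" using assms(6) by simp
      ultimately show ?thesis using that(1) \<open>s = 1 \<or> s = -1\<close> by (auto simp: z_def)
    qed
    ultimately have "- \<kappa> * sqnorm n u \<le> (\<Sum>j\<le>d. pairing n (F j) (\<lambda>a c. z (j, a, c)))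
        + pairing n (F (Suc d)) (\<lambda>a c. z (Suc d, a, c))" by (intro F) auto
    also have "pairing n (F (Suc d)) (\<lambda>a c. z (Suc d, a, c)) = qform n (F (Suc d)) u"
      by (simp add: z_def pairing_rank_one)
    also have "(\<Sum>j\<le>d. pairing n (F j) (\<lambda>a c. z (j, a, c))) = (\<Sum>j\<le>d. if j = i then s * qform n (F i) u else 0)"
    proof (intro sum.cong refl)
      fix j assume "j \<in> {..d}"
      then show "pairing n (F j) (\<lambda>a c. z (j, a, c)) = (if j = i then s * qform n (F i) u else 0)"
        by (cases "j = i") (simp_all add: z_def pairing_scale_right pairing_rank_one[symmetric], simp add: pairing_def)
    qed
    finally show ?thesis using that(1) by simp
  qed
  \<comment> \<open>\<open>\<kappa>\<close> repairs nonnegativity on the cone; in \<open>w\<close> one \<open>\<kappa>\<close> pays for the test error, one for the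
    change of \<open>f\<^sub>0\<close>, and one leaves \<open>w\<close> definite.\<close>
  define f where "f = (\<lambda>j a c. F j a c + of_real (if j = 0 then \<kappa> else 0) * unitf a c)"
  define w where "w = (\<lambda>a c. F (Suc d) a c + of_real (3 * \<kappa>) * unitf a c)"
  have herm_f: "herm n (f j)" if "j \<le> d" for j
    unfolding f_def using herm_F that by (intro herm_add herm_scale) auto
  have herm_w: "herm n w" unfolding w_def using herm_F by (intro herm_add herm_scale) auto
  have qf: "qform n (f j) u = qform n (F j) u + (if j = 0 then \<kappa> else 0) * sqnorm n u" for j u
    unfolding f_def qform_add qform_scale qform_unit ..
  have qw: "qform n w u = qform n (F (Suc d)) u + 3 * \<kappa> * sqnorm n u" for u
    unfolding w_def qform_add qform_scale qform_unit ..
  show thesis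
  proof (rule that)
    fix j assume j: "j \<le> d"
    have kk: "0 \<le> \<kappa> * sqnorm n u" "0 \<le> (if j = 0 then \<kappa> else 0) * sqnorm n u"
      "(if j = 0 then \<kappa> else 0) * sqnorm n u \<le> \<kappa> * sqnorm n u" for u using kappa by auto
    have t: "- (\<kappa> * sqnorm n u) \<le> qform n (F (Suc d)) u + qform n (F j) u"
      "- (\<kappa> * sqnorm n u) \<le> qform n (F (Suc d)) u - qform n (F j) u" for u
      using test[OF j, of 1 u] test[OF j, of "-1" u] by simp_all
    have "0 \<le> qform n w u + qform n (f j) u" "0 \<le> qform n w u - qform n (f j) u" for u
      using kk[of u] t[of u] unfolding qf qw by linarith+
    then show "pos_semidef n (\<lambda>a c. w a c + f j a c)" "pos_semidef n (\<lambda>a c. w a c - f j a c)"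
      unfolding pos_semidef_def qform_add qform_diff
      using herm_add[OF herm_w herm_f[OF j]] herm_diff[OF herm_w herm_f[OF j]] by blast+
  next
    fix u assume "sqnorm n u \<noteq> 0"
    then have "0 < \<kappa> * sqnorm n u" using kappa sqnorm_nonneg[of n u] by (simp add: less_le)
    then show "0 < qform n w u" using test[of 0 1 u] test[of 0 "-1" u] by (simp add: qw)
  next
    fix g assume g: "g \<in> compression_cone d n S"
    define z where "z = (\<lambda>(j, a, c). if j = Suc d then 0 else g j a c)"
    have tr: "0 \<le> pairing n unitf (g 0)"
    proof -
      have "0 \<le> R * qform n (g 0) u" for u
        using qform_compression_cone(2)[OF g assms(5), of 0 u] by linarith
      then have "pos_semidef n (g 0)" unfolding pos_semidef_def using qform_compression_cone(1)[OF g assms(5), of 0] assms(6)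
        by (simp add: zero_le_mult_iff)
      then show ?thesis using pairing_nonneg pos_semidef_unit by blast
    qed
    have "z \<in> K" unfolding K_def
      using pos_semidef_0 by (intro CollectI bexI[OF _ g] allI impI conjI) (simp_all add: z_def)
    moreover have "cmod (z (j, a, c)) \<le> R * pairing n unitf (g 0)" if "j \<le> Suc d" "a < n" "c < n" for j a c
      using bounded_entry[OF compression_cone_pos[OF g assms(5)] that(2,3), of j] that(1) tr assms(6)
      by (cases "j = Suc d") (auto simp: z_def)
    ultimately have "- \<kappa> * pairing n unitf (g 0) \<le> (\<Sum>j\<le>d. pairing n (F j) (\<lambda>a c. z (j, a, c)))
        + pairing n (F (Suc d)) (\<lambda>a c. z (Suc d, a, c))" using tr by (intro F) auto
    also have "(\<Sum>j\<le>d. pairing n (F j) (\<lambda>a c. z (j, a, c))) = (\<Sum>j\<le>d. pairing n (F j) (g j))"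
      by (intro sum.cong refl pairing_cong) (auto simp: z_def)
    finally have "- \<kappa> * pairing n unitf (g 0) \<le> (\<Sum>j\<le>d. pairing n (F j) (g j))"
      by (simp add: z_def pairing_def)
    moreover have "(\<Sum>j\<le>d. pairing n (f j) (g j)) = (\<Sum>j\<le>d. pairing n (F j) (g j)) + \<kappa> * pairing n unitf (g 0)"
      unfolding f_def pairing_add_left pairing_scale_left sum.distrib
      by (simp add: if_distrib[of "\<lambda>t. t * _"] sum.delta cong: if_cong)
    ultimately show "0 \<le> (\<Sum>j\<le>d. pairing n (f j) (g j))" by simp
  next
    have uu: "pairing n unitf unitf = real n" by (simp add: pairing_unit unitf_def)
    have "(\<Sum>j\<le>d. pairing n (f j) (coord A j)) = (\<Sum>j\<le>d. pairing n (F j) (coord A j)) + \<kappa> * pairing n unitf (coord A 0)"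
      unfolding f_def pairing_add_left pairing_scale_left sum.distrib
      by (simp add: if_distrib[of "\<lambda>t. t * _"] sum.delta cong: if_cong)
    moreover have "pairing n w unitf = pairing n (F (Suc d)) unitf + 3 * \<kappa> * real n"
      unfolding w_def pairing_add_left pairing_scale_left uu ..
    ultimately have "(\<Sum>j\<le>d. pairing n (f j) (coord A j)) + e * pairing n w unitf
        \<le> \<eta> - r\<^sup>2 + \<kappa> * real n + e * (3 * \<kappa> * real n)"
      using Fx uu by (simp add: coord_def algebra_simps)
    also have "\<dots> = \<eta> * C - r\<^sup>2" by (simp add: C_def \<kappa>_def algebra_simps)
    finally show "(\<Sum>j\<le>d. pairing n (f j) (coord A j)) + e * pairing n w unitf \<le> 0"
      using eta(2) by simp
  qed
qed

section \<open>Normalising the functional\<close>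

text \<open>A congruence of the coefficient can be moved to the compressing matrix.\<close>

lemma pairing_compress:
  "pairing n (compress n F U) (compress k X V) = pairing n F (compress k X (\<lambda>c i. \<Sum>f<n. U f c * V f i))"
proof -
  let ?h = "\<lambda>e f a c. cnj (U e a) * F a c * U f c * sesq k X (V e) (V f)"
  have "(\<Sum>e<n. \<Sum>f<n. compress n F U e f * compress k X V e f)
     = (\<Sum>e<n. \<Sum>f<n. \<Sum>a<n. \<Sum>c<n. ?h e f a c)"
    by (simp add: compress_def sesq_def[of n] sum_distrib_right)
  also have "\<dots> = (\<Sum>e<n. \<Sum>a<n. \<Sum>f<n. \<Sum>c<n. ?h e f a c)"
    by (intro sum.cong refl sum.swap)
  also have "\<dots> = (\<Sum>a<n. \<Sum>e<n. \<Sum>f<n. \<Sum>c<n. ?h e f a c)"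
    by (rule sum.swap)
  also have "\<dots> = (\<Sum>a<n. \<Sum>e<n. \<Sum>c<n. \<Sum>f<n. ?h e f a c)"
    by (intro sum.cong refl sum.swap)
  also have "\<dots> = (\<Sum>a<n. \<Sum>c<n. \<Sum>e<n. \<Sum>f<n. ?h e f a c)"
    by (intro sum.cong refl sum.swap)
  also have "\<dots> = (\<Sum>a<n. \<Sum>c<n. F a c * compress k X (\<lambda>c i. \<Sum>f<n. U f c * V f i) a c)"
    unfolding compress_def sesq_sum_left sesq_sum_right
    by (simp add: sum_distrib_left algebra_simps)
  finally show ?thesis by (simp add: pairing_def)
qed

text \<open>The congruence by \<open>T\<^sup>-\<^sup>1\<close> that takes \<open>w = TT\<^sup>*\<close>
  to 1 takes \<open>f\<^sub>j\<close> to \<open>b\<^sub>j\<close>.  Nonnegativity survives because the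
  cone is invariant under a change of \<open>V\<close>, and for \<open>V\<close> the entrywise conjugate
  of \<open>T\<close> the value at \<open>A\<close> is that of \<open>f\<close>, whereas the squared
  length of \<open>V\<close> is the trace of \<open>w\<close>.\<close>

lemma normalised_separating_functional:
  fixes A :: "complex mat list"
  assumes "1 \<le> d" "1 \<le> n" "matrix_convex d S" "S \<noteq> {}" "level_bounded d R S" "1 \<le> R" "0 < e"
    and A: "A \<in> sa_tuples d n"
    and far: "\<And>g. g \<in> compression_cone d n S \<Longrightarrow>
      \<exists>j\<le>d. \<exists>u. 2 * e * sqnorm n u < \<bar>qform n (coord A j) u - qform n (g j) u\<bar>"
  obtains b V where
    "\<And>j. j \<le> d \<Longrightarrow> pos_semidef n (\<lambda>a c. unitf a c + b j a c)" "\<And>j. j \<le> d \<Longrightarrow> pos_semidef n (\<lambda>a c. unitf a c - b j a c)"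
    "\<And>k X V. X \<in> S \<Longrightarrow> X \<in> sa_tuples d k \<Longrightarrow> 1 \<le> k \<Longrightarrow> 0 \<le> (\<Sum>j\<le>d. pairing n (b j) (compress k (coord X j) V))"
    "(\<Sum>j\<le>d. pairing n (b j) (compress n (coord A j) V)) \<le> - e * (\<Sum>a<n. sqnorm n (V a))"
    "0 < (\<Sum>a<n. sqnorm n (V a))"
proof -
  obtain f w where fw: "\<And>j. j \<le> d \<Longrightarrow> pos_semidef n (\<lambda>a c. w a c + f j a c)"
    "\<And>j. j \<le> d \<Longrightarrow> pos_semidef n (\<lambda>a c. w a c - f j a c)"
    "\<And>u. sqnorm n u \<noteq> 0 \<Longrightarrow> 0 < qform n w u"
    "\<And>g. g \<in> compression_cone d n S \<Longrightarrow> 0 \<le> (\<Sum>j\<le>d. pairing n (f j) (g j))"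
    "(\<Sum>j\<le>d. pairing n (f j) (coord A j)) + e * pairing n w unitf \<le> 0"
    by (rule separating_functional[OF assms(1-8) far]) (assumption | rule that; assumption)+
  have "pos_semidef n w"
    using pos_semidef_scale[OF pos_semidef_add[OF fw(1)[of 0] fw(2)[of 0]], of "1/2"] by (simp add: field_simps)
  then obtain T U :: "nat \<Rightarrow> nat \<Rightarrow> complex" where
    w: "\<And>a c. a < n \<Longrightarrow> c < n \<Longrightarrow> w a c = (\<Sum>e<n. T a e * cnj (T c e))" and
    UT: "\<And>a c. a < n \<Longrightarrow> c < n \<Longrightarrow> (\<Sum>e<n. U a e * T e c) = unitf a c" and
    TU: "\<And>a c. a < n \<Longrightarrow> c < n \<Longrightarrow> (\<Sum>e<n. T a e * U e c) = unitf a c"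
    using invertible_factor[OF _ fw(3)] by blast
  define U' where "U' = (\<lambda>e a. cnj (U e a))"
  define b where "b = (\<lambda>j. compress n (f j) U')"
  define V where "V = (\<lambda>a i. cnj (T i a))"
  have w_unit: "compress n w U' p q = unitf p q" if "p < n" "q < n" for p q
  proof -
    have "compress n w U' p q = (\<Sum>a<n. \<Sum>c<n. \<Sum>e<n. (U p a * T a e) * cnj (U q c * T c e))"
      unfolding compress_def sesq_def U'_def using w
      by (intro sum.cong refl) (simp add: sum_distrib_left sum_distrib_right algebra_simps)
    also have "\<dots> = (\<Sum>a<n. \<Sum>e<n. \<Sum>c<n. (U p a * T a e) * cnj (U q c * T c e))"
      by (intro sum.cong refl sum.swap)
    also have "\<dots> = (\<Sum>e<n. \<Sum>a<n. \<Sum>c<n. (U p a * T a e) * cnj (U q c * T c e))"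
      by (rule sum.swap)
    also have "\<dots> = (\<Sum>e<n. (\<Sum>a<n. U p a * T a e) * cnj (\<Sum>c<n. U q c * T c e))"
      unfolding cnj_sum sum_product ..
    also have "\<dots> = (\<Sum>e<n. if e = p then unitf q p else 0)"
      using UT[OF that(1)] UT[OF that(2)] by (intro sum.cong refl) (auto simp: unitf_def)
    also have "\<dots> = unitf p q" using that by (auto simp: unitf_def)
    finally show "compress n w U' p q = unitf p q" .
  qed
  show thesis
  proof (rule that)
    fix j assume j: "j \<le> d"
    have "pos_semidef n (compress n (\<lambda>a c. w a c + f j a c) U')" using pos_semidef_compress[OF fw(1)[OF j]] .
    moreover have "compress n (\<lambda>a c. w a c + f j a c) U' a c = unitf a c + b j a c" if "a < n" "c < n" for a c
      using w_unit[OF that] by (simp add: compress_def sesq_add_mat b_def)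
    ultimately show "pos_semidef n (\<lambda>a c. unitf a c + b j a c)"
      using pos_semidef_cong[of n "compress n (\<lambda>a c. w a c + f j a c) U'" "\<lambda>a c. unitf a c + b j a c"] by simp
    have "pos_semidef n (compress n (\<lambda>a c. w a c - f j a c) U')" using pos_semidef_compress[OF fw(2)[OF j]] .
    moreover have "compress n (\<lambda>a c. w a c - f j a c) U' a c = unitf a c - b j a c" if "a < n" "c < n" for a c
      using w_unit[OF that] by (simp add: compress_def sesq_diff_mat b_def)
    ultimately show "pos_semidef n (\<lambda>a c. unitf a c - b j a c)"
      using pos_semidef_cong[of n "compress n (\<lambda>a c. w a c - f j a c) U'" "\<lambda>a c. unitf a c - b j a c"] by simp
  next
    fix k X V assume "X \<in> S" "X \<in> sa_tuples d k" "1 \<le> (k::nat)"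
    then show "0 \<le> (\<Sum>j\<le>d. pairing n (b j) (compress k (coord X j) V))"
      unfolding b_def pairing_compress by (intro fw(4)) (rule compression_coneI, auto)
  next
    have "sqnorm n (V a) = (\<Sum>i<n. (cmod (T i a))\<^sup>2)" for a by (simp add: sqnorm_def V_def)
    then have "(\<Sum>a<n. sqnorm n (V a)) = (\<Sum>i<n. \<Sum>a<n. (cmod (T i a))\<^sup>2)"
      by (simp only:) (rule sum.swap)
    also have "\<dots> = (\<Sum>i<n. Re (w i i))"
    proof (intro sum.cong refl)
      fix i assume "i \<in> {..<n}"
      then have "w i i = (\<Sum>e<n. T i e * cnj (T i e))" using w by simp
      then show "(\<Sum>a<n. (cmod (T i a))\<^sup>2) = Re (w i i)"
        by (simp only: complex_norm_square[symmetric] Re_sum Re_complex_of_real)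
    qed
    also have tr: "\<dots> = pairing n w unitf" by (simp add: pairing_unit)
    finally have V: "(\<Sum>a<n. sqnorm n (V a)) = pairing n w unitf" .
    have "0 < Re (w i i)" if "i < n" for i
    proof -
      have "sqnorm n (unitf i) = (\<Sum>k<n. if k = i then 1 else 0)"
        unfolding sqnorm_def by (intro sum.cong refl) (auto simp: unitf_def)
      then have "0 < qform n w (unitf i)" using that by (intro fw(3)) simp
      then show ?thesis using sesq_basis[OF that that] by (simp add: qform_def)
    qed
    then have "0 < (\<Sum>i<n. Re (w i i))" using assms(2) by (intro sum_pos) (auto simp: lessThan_empty_iff)
    then show "0 < (\<Sum>a<n. sqnorm n (V a))" by (simp add: V tr)
    have "compress n (coord A j) (\<lambda>c i. \<Sum>f<n. U' f c * V f i) a c = coord A j a c" if "a < n" "c < n" for j a c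
    proof -
      have *: "(\<Sum>f<n. U' f c * V f i) = unitf c i" if "c < n" "i < n" for c i
      proof -
        have "(\<Sum>f<n. U' f c * V f i) = cnj (\<Sum>f<n. T i f * U f c)"
          unfolding cnj_sum by (intro sum.cong refl) (simp add: U'_def V_def mult.commute)
        then show ?thesis using TU[OF that(2,1)] by (auto simp: unitf_def)
      qed
      have "compress n (coord A j) (\<lambda>c i. \<Sum>f<n. U' f c * V f i) a c = sesq n (coord A j) (unitf a) (unitf c)"
        unfolding compress_def using * that by (intro sesq_cong) auto
      then show ?thesis using sesq_basis[OF that] by simp
    qed
    then have "(\<Sum>j\<le>d. pairing n (b j) (compress n (coord A j) V)) = (\<Sum>j\<le>d. pairing n (f j) (coord A j))"
      unfolding b_def pairing_compress by (intro sum.cong refl pairing_cong) auto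
    then show "(\<Sum>j\<le>d. pairing n (b j) (compress n (coord A j) V)) \<le> - e * (\<Sum>a<n. sqnorm n (V a))"
      using fw(5) by (simp add: V)
  qed
qed

section \<open>Operator norms of selfadjoint matrices\<close>

definition mat_apply :: "nat \<Rightarrow> (nat \<Rightarrow> nat \<Rightarrow> complex) \<Rightarrow> (nat \<Rightarrow> complex) \<Rightarrow> nat \<Rightarrow> complex" where
  "mat_apply n X u i = (\<Sum>j<n. X i j * u j)"

lemma sesq_mat_apply: "sesq n X u v = (\<Sum>i<n. cnj (u i) * mat_apply n X v i)"
  by (simp add: sesq_def mat_apply_def sum_distrib_left algebra_simps)

lemma sesq_mat_apply_self: "sesq n X (mat_apply n X u) u = of_real (sqnorm n (mat_apply n X u))"
proof -
  have "sesq n X (mat_apply n X u) u = (\<Sum>i<n. mat_apply n X u i * cnj (mat_apply n X u i))"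
    unfolding sesq_mat_apply by (intro sum.cong refl mult.commute)
  then show ?thesis unfolding complex_norm_square[symmetric] sqnorm_def by simp
qed

text \<open>Apply the inequality of arithmetic and geometric means to \<open>M
  |u\<^sub>i|\<^sup>2\<close> and \<open>|y\<^sub>i|\<^sup>2 / M\<close>.\<close>

lemma inner_bound:
  assumes "sqnorm n y \<le> M\<^sup>2 * sqnorm n u" "0 \<le> M"
  shows "\<bar>Re (\<Sum>i<n. cnj (u i) * y i)\<bar> \<le> M * sqnorm n u"
proof (cases "M = 0")
  case True
  then have "sqnorm n y = 0" using assms(1) sqnorm_nonneg[of n y] by simp
  then have "\<forall>i<n. y i = 0" by (simp add: sqnorm_def sum_nonneg_eq_0_iff)
  then show ?thesis using True by simp
next
  case False
  then have M: "0 < M" using assms by simp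
  have "\<bar>Re (\<Sum>i<n. cnj (u i) * y i)\<bar> \<le> (\<Sum>i<n. cmod (cnj (u i) * y i))"
    by (rule order.trans[OF abs_Re_le_cmod norm_sum])
  also have "\<dots> \<le> (\<Sum>i<n. (M * (cmod (u i))\<^sup>2 + (cmod (y i))\<^sup>2 / M) / 2)"
  proof (intro sum_mono)
    fix i
    have "2 * (M * cmod (u i)) * cmod (y i) \<le> (M * cmod (u i))\<^sup>2 + (cmod (y i))\<^sup>2"
      by (rule sum_squares_bound)
    then have "M * (2 * (cmod (u i) * cmod (y i))) \<le> M * (M * (cmod (u i))\<^sup>2 + (cmod (y i))\<^sup>2 / M)"
      using M by (simp add: power2_eq_square algebra_simps)
    then have "2 * (cmod (u i) * cmod (y i)) \<le> M * (cmod (u i))\<^sup>2 + (cmod (y i))\<^sup>2 / M"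
      using M by (simp only: mult_le_cancel_left_pos)
    then show "cmod (cnj (u i) * y i) \<le> (M * (cmod (u i))\<^sup>2 + (cmod (y i))\<^sup>2 / M) / 2"
      by (simp add: norm_mult)
  qed
  also have "\<dots> = (M * sqnorm n u + sqnorm n y / M) / 2"
    by (simp add: sqnorm_def sum.distrib sum_distrib_left sum_divide_distrib add_divide_distrib)
  also have "\<dots> \<le> (M * sqnorm n u + M * sqnorm n u) / 2"
    using assms(1) M by (simp add: divide_le_eq power2_eq_square mult.commute mult.left_commute)
  finally show ?thesis by simp
qed

text \<open>For a selfadjoint matrix the numerical radius is the norm: polarisation bounds the real part
  of the form at \<open>(u, v)\<close>, and \<open>u = Xv / M\<close> is the right choice.\<close>

lemma mat_apply_bound:
  assumes "herm n X" "\<And>u. \<bar>qform n X u\<bar> \<le> M * sqnorm n u" "0 \<le> M"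
  shows "sqnorm n (mat_apply n X v) \<le> M\<^sup>2 * sqnorm n v"
proof -
  have polar: "Re (sesq n X u v) \<le> M / 2 * (sqnorm n u + sqnorm n v)" for u
  proof -
    have par: "sqnorm n (\<lambda>i. u i + v i) + sqnorm n (\<lambda>i. u i - v i) = 2 * (sqnorm n u + sqnorm n v)"
      unfolding qform_unit[symmetric] qform_def sesq_add_vec sesq_diff_vec by simp
    have "4 * Re (sesq n X u v) = qform n X (\<lambda>i. u i + v i) - qform n X (\<lambda>i. u i - v i)"
      unfolding qform_def sesq_add_vec sesq_diff_vec sesq_herm[OF assms(1), of v u] by simp
    also have "\<dots> \<le> M * sqnorm n (\<lambda>i. u i + v i) + M * sqnorm n (\<lambda>i. u i - v i)"
      using assms(2)[of "\<lambda>i. u i + v i"] assms(2)[of "\<lambda>i. u i - v i"] by linarith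
    also have "\<dots> = M * (2 * (sqnorm n u + sqnorm n v))" unfolding par[symmetric] by (simp add: algebra_simps)
    finally show ?thesis by (simp add: algebra_simps)
  qed
  let ?y = "mat_apply n X v"
  show ?thesis
  proof (cases "M = 0")
    case True
    have "sqnorm n ?y \<le> 0" using polar[of ?y] unfolding sesq_mat_apply_self True by simp
    then show ?thesis using True by simp
  next
    case False
    then have M: "0 < M" using assms by simp
    have "sesq n X (\<lambda>i. of_real (1 / M) * ?y i) v = of_real (sqnorm n ?y / M)"
      unfolding sesq_scale_vec sesq_mat_apply_self by simp
    moreover have "sqnorm n (\<lambda>i. of_real (1 / M) * ?y i) = sqnorm n ?y / M\<^sup>2"
      using M by (simp only: qform_unit[symmetric] qform_scale_vec) (simp add: norm_divide power_divide)
    ultimately have "sqnorm n ?y / M \<le> M / 2 * (sqnorm n ?y / M\<^sup>2 + sqnorm n v)"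
      using polar[of "\<lambda>i. of_real (1 / M) * ?y i"] by simp
    then show ?thesis using M by (simp add: field_simps power2_eq_square)
  qed
qed

lemma vec_l2norm_nonneg: "0 \<le> vec_l2norm v"
  by (simp add: vec_l2norm_def sum_nonneg)

lemma vec_l2norm_sq: "v \<in> carrier_vec n \<Longrightarrow> (vec_l2norm v)\<^sup>2 = sqnorm n (\<lambda>i. v $ i)"
  unfolding vec_l2norm_def sqnorm_def by (subst real_sqrt_pow2) (auto intro: sum_nonneg)

lemma vec_l2norm_mult:
  assumes "A \<in> carrier_mat n n" "v \<in> carrier_vec n"
  shows "(vec_l2norm (A *\<^sub>v v))\<^sup>2 = sqnorm n (mat_apply n (entry A) (\<lambda>i. v $ i))"
    and "(vec_l2norm v)\<^sup>2 = sqnorm n (\<lambda>i. v $ i)"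
proof -
  have Av: "A *\<^sub>v v \<in> carrier_vec n" using assms by simp
  show "(vec_l2norm (A *\<^sub>v v))\<^sup>2 = sqnorm n (mat_apply n (entry A) (\<lambda>i. v $ i))"
    unfolding vec_l2norm_sq[OF Av] sqnorm_def mat_apply_def using mult_vec_entry[OF assms] by simp
  show "(vec_l2norm v)\<^sup>2 = sqnorm n (\<lambda>i. v $ i)" by (rule vec_l2norm_sq[OF assms(2)])
qed

lemma vec_l2norm_mult_le:
  assumes "A \<in> carrier_mat n n" "herm n (entry A)" "\<And>u. \<bar>qform n (entry A) u\<bar> \<le> M * sqnorm n u" "0 \<le> M"
    and "v \<in> carrier_vec n" "vec_l2norm v \<le> 1"
  shows "vec_l2norm (A *\<^sub>v v) \<le> M"
proof -
  have "(vec_l2norm (A *\<^sub>v v))\<^sup>2 \<le> M\<^sup>2 * (vec_l2norm v)\<^sup>2"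
    unfolding vec_l2norm_mult[OF assms(1,5)] using mat_apply_bound[OF assms(2,3,4)] .
  also have "\<dots> \<le> M\<^sup>2 * 1"
    using assms(6) vec_l2norm_nonneg[of v] by (intro mult_left_mono) (auto simp: power_le_one)
  finally have "(vec_l2norm (A *\<^sub>v v))\<^sup>2 \<le> M\<^sup>2" by simp
  then show ?thesis by (rule power2_le_imp_le[OF _ assms(4)])
qed

lemma op_norm_le:
  assumes "A \<in> carrier_mat n n" "herm n (entry A)" "\<And>u. \<bar>qform n (entry A) u\<bar> \<le> M * sqnorm n u" "0 \<le> M"
  shows "op_norm A \<le> M"
  unfolding op_norm_def
proof (rule cSup_least)
  have "vec_l2norm (0\<^sub>v n) \<le> 1" by (simp add: vec_l2norm_def)
  then show "{vec_l2norm (A *\<^sub>v v) |v. v \<in> carrier_vec (dim_col A) \<and> vec_l2norm v \<le> 1} \<noteq> {}"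
    using assms(1) by (auto intro!: exI[of _ "0\<^sub>v n"])
qed (use vec_l2norm_mult_le[OF assms] assms(1) in auto)

text \<open>Some bound is needed before the supremum in the operator norm can be used.\<close>

lemma qform_has_bound:
  obtains M where "0 \<le> M" "\<And>u. \<bar>qform n X u\<bar> \<le> M * sqnorm n u"
proof -
  have "cmod (X a c) \<le> (\<Sum>i<n. \<Sum>j<n. cmod (X i j))" if "a < n" "c < n" for a c
  proof -
    have "cmod (X a c) \<le> (\<Sum>j<n. cmod (X a j))" using that by (intro member_le_sum) auto
    also have "\<dots> \<le> (\<Sum>i<n. \<Sum>j<n. cmod (X i j))"
      using that by (intro member_le_sum[of a "{..<n}" "\<lambda>i. \<Sum>j<n. cmod (X i j)"]) (auto intro: sum_nonneg)
    finally show ?thesis .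
  qed
  from qform_entries_small[OF this] show thesis
    by (intro that[of "real n * (\<Sum>i<n. \<Sum>j<n. cmod (X i j))"]) (auto intro!: mult_nonneg_nonneg sum_nonneg)
qed

lemma op_norm_mat_apply:
  assumes "A \<in> carrier_mat n n" "herm n (entry A)"
  shows "0 \<le> op_norm A" "sqnorm n (mat_apply n (entry A) u) \<le> (op_norm A)\<^sup>2 * sqnorm n u"
proof -
  obtain M where M: "0 \<le> M" "\<And>u. \<bar>qform n (entry A) u\<bar> \<le> M * sqnorm n u" using qform_has_bound by blast
  have ub: "vec_l2norm (A *\<^sub>v v) \<le> op_norm A" if "v \<in> carrier_vec n" "vec_l2norm v \<le> 1" for v
    unfolding op_norm_def
  proof (rule cSup_upper)
    show "bdd_above {vec_l2norm (A *\<^sub>v v) |v. v \<in> carrier_vec (dim_col A) \<and> vec_l2norm v \<le> 1}"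
      by (rule bdd_aboveI[of _ M]) (use vec_l2norm_mult_le[OF assms M(2,1)] assms(1) in auto)
  qed (use that assms(1) in auto)
  have "vec_l2norm (0\<^sub>v n) \<le> 1" by (simp add: vec_l2norm_def)
  then show nn: "0 \<le> op_norm A" using ub[of "0\<^sub>v n"] vec_l2norm_nonneg[of "A *\<^sub>v 0\<^sub>v n"] by simp
  show "sqnorm n (mat_apply n (entry A) u) \<le> (op_norm A)\<^sup>2 * sqnorm n u"
  proof (cases "sqnorm n u = 0")
    case True
    then have "\<forall>i<n. u i = 0" by (simp add: sqnorm_def sum_nonneg_eq_0_iff)
    then show ?thesis by (simp add: sqnorm_def mat_apply_def)
  next
    case False
    define t where "t = sqrt (sqnorm n u)"
    have t: "0 < t" "t\<^sup>2 = sqnorm n u" using False sqnorm_nonneg[of n u] by (auto simp: t_def less_le)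
    define v where "v = vec n (\<lambda>i. of_real (1 / t) * u i)"
    have v: "v \<in> carrier_vec n" by (simp add: v_def)
    have sc: "sqnorm n (\<lambda>i. of_real (1 / t) * z i) = sqnorm n z / t\<^sup>2" for z
      by (simp only: qform_unit[symmetric] qform_scale_vec) (simp add: norm_divide power_divide)
    have vi: "v $ i = of_real (1 / t) * u i" if "i < n" for i using that by (simp add: v_def)
    have "(vec_l2norm v)\<^sup>2 = sqnorm n (\<lambda>i. of_real (1 / t) * u i)"
      unfolding vec_l2norm_mult[OF assms(1) v] sqnorm_def using vi by simp
    also have "\<dots> = 1" unfolding sc t(2) using False by simp
    finally have "vec_l2norm v \<le> 1" using vec_l2norm_nonneg[of v] by (simp add: power2_eq_1_iff)
    then have "(vec_l2norm (A *\<^sub>v v))\<^sup>2 \<le> (op_norm A)\<^sup>2"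
      using ub[OF v] vec_l2norm_nonneg by (intro power_mono) auto
    moreover have "(vec_l2norm (A *\<^sub>v v))\<^sup>2 = sqnorm n (\<lambda>i. of_real (1 / t) * mat_apply n (entry A) u i)"
      unfolding vec_l2norm_mult[OF assms(1) v] sqnorm_def mat_apply_def sum_distrib_left
      using vi by (intro sum.cong refl arg_cong[of _ _ "\<lambda>z. (cmod z)\<^sup>2"]) auto
    ultimately have "sqnorm n (mat_apply n (entry A) u) / t\<^sup>2 \<le> (op_norm A)\<^sup>2" by (simp only: sc)
    then show ?thesis unfolding pos_divide_le_eq[OF zero_less_power[OF t(1)]] unfolding t(2) .
  qed
qed

lemma op_norm_ge:
  assumes "A \<in> carrier_mat n n" "herm n (entry A)"
  shows "\<bar>qform n (entry A) u\<bar> \<le> op_norm A * sqnorm n u"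
  unfolding qform_def sesq_mat_apply using inner_bound[OF op_norm_mat_apply(2,1)[OF assms]] .

section \<open>Norms of selfadjoint tuples\<close>

lemma mat_sum_carrier: "\<forall>A\<in>set As. A \<in> carrier_mat n n \<Longrightarrow> mat_sum n As \<in> carrier_mat n n"
  by (induction As) (auto simp: mat_sum_def)

lemma mat_sum_form:
  assumes "\<forall>A\<in>set As. A \<in> carrier_mat n n"
  shows "qform n (entry (mat_sum n As)) u = (\<Sum>A\<leftarrow>As. qform n (entry A) u)"
    and "\<forall>A\<in>set As. herm n (entry A) \<Longrightarrow> herm n (entry (mat_sum n As))"
proof -
  have "qform n (entry (mat_sum n As)) u = (\<Sum>A\<leftarrow>As. qform n (entry A) u) \<and>
    ((\<forall>A\<in>set As. herm n (entry A)) \<longrightarrow> herm n (entry (mat_sum n As)))"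
    using assms
  proof (induction As)
    case Nil
    have "entry (mat_sum n []) i j = 0" if "i < n" "j < n" for i j using that by (simp add: entry_def mat_sum_def)
    then show ?case by (simp add: herm_def qform_def sesq_def)
  next
    case (Cons A As)
    have "mat_sum n As \<in> carrier_mat n n" using Cons.prems by (intro mat_sum_carrier) auto
    then have e: "entry (mat_sum n (A # As)) i j = entry A i j + entry (mat_sum n As) i j" if "i < n" "j < n" for i j
      using that Cons.prems by (simp add: entry_def mat_sum_def)
    have "qform n (entry (mat_sum n (A # As))) u = qform n (\<lambda>i j. entry A i j + entry (mat_sum n As) i j) u"
      using e by (intro qform_cong) auto
    moreover have "herm n (entry (mat_sum n (A # As))) = herm n (\<lambda>i j. entry A i j + entry (mat_sum n As) i j)"
      using e by (intro herm_cong) auto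
    ultimately show ?case using Cons by (auto intro: herm_add)
  qed
  then show "qform n (entry (mat_sum n As)) u = (\<Sum>A\<leftarrow>As. qform n (entry A) u)"
    "\<forall>A\<in>set As. herm n (entry A) \<Longrightarrow> herm n (entry (mat_sum n As))" by auto
qed

lemma qform_square:
  assumes "A \<in> carrier_mat n n" "herm n (entry A)"
  shows "qform n (entry (A * A)) u = sqnorm n (mat_apply n (entry A) u)" "herm n (entry (A * A))"
proof -
  have e: "entry (A * A) i j = (\<Sum>l<n. entry A i l * entry A l j)" if "i < n" "j < n" for i j
    using assms that by (auto simp: entry_def scalar_prod_def atLeast0LessThan intro!: sum.cong)
  have "sesq n (entry (A * A)) u u = (\<Sum>i<n. cnj (u i) * (\<Sum>j<n. \<Sum>l<n. entry A i l * (entry A l j * u j)))"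
    unfolding sesq_def sum_distrib_left using e
    by (intro sum.cong refl) (simp add: sum_distrib_left sum_distrib_right algebra_simps)
  also have "\<dots> = (\<Sum>i<n. cnj (u i) * (\<Sum>l<n. \<Sum>j<n. entry A i l * (entry A l j * u j)))"
    by (intro sum.cong refl arg_cong2[of _ _ _ _ "(*)"] sum.swap)
  also have "\<dots> = sesq n (entry A) u (mat_apply n (entry A) u)"
    unfolding sesq_mat_apply by (simp add: mat_apply_def sum_distrib_left)
  also have "\<dots> = cnj (sesq n (entry A) (mat_apply n (entry A) u) u)" by (rule sesq_herm[OF assms(2)])
  also have "\<dots> = of_real (sqnorm n (mat_apply n (entry A) u))" by (simp add: sesq_mat_apply_self)
  finally show "qform n (entry (A * A)) u = sqnorm n (mat_apply n (entry A) u)" by (simp add: qform_def)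
  show "herm n (entry (A * A))" unfolding herm_def
  proof (intro allI impI)
    fix i j assume ij: "i < n" "j < n"
    have "(\<Sum>l<n. entry A j l * entry A l i) = (\<Sum>l<n. cnj (entry A i l * entry A l j))"
    proof (intro sum.cong refl)
      fix l assume "l \<in> {..<n}"
      then have "entry A j l = cnj (entry A l j)" "entry A l i = cnj (entry A i l)"
        using hermD[OF assms(2)] ij by blast+
      then show "entry A j l * entry A l i = cnj (entry A i l * entry A l j)" by simp
    qed
    then show "entry (A * A) j i = cnj (entry (A * A) i j)" using e ij by simp
  qed
qed

lemma herm_nth:
  assumes "X \<in> sa_tuples d k" "i < d"
  shows "herm k (entry (X ! i))"
  using herm_coord[OF assms(1), of "Suc i"] assms(2) by (simp add: coord_def)

lemma sa_tuples_level: "1 \<le> d \<Longrightarrow> X \<in> sa_tuples d k \<Longrightarrow> tuple_level X = k"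
  using sa_tuplesD(1)[of X d k] sa_tuplesD(2)[of X d k 0]
  by (cases X) (auto simp: tuple_level_def)

lemma mat_adjoint_herm:
  assumes "A \<in> carrier_mat n n" "herm n (entry A)"
  shows "mat_adjoint A = A"
proof (rule eq_matI)
  have dim: "mat_adjoint A \<in> carrier_mat n n" using assms(1) by (simp add: mat_adjoint_def mat_of_rows_def)
  then show "dim_row (mat_adjoint A) = dim_row A" "dim_col (mat_adjoint A) = dim_col A" using assms(1) by auto
  fix i j assume "i < dim_row A" "j < dim_col A"
  then have ij: "i < n" "j < n" using assms(1) by auto
  show "mat_adjoint A $$ (i, j) = A $$ (i, j)"
    using entry_mat_adjoint[OF assms(1) ij] hermD[OF assms(2) ij(2,1)] by (simp add: entry_def)
qed

lemma sa_tuplesI: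
  assumes "length X = d" "\<And>i. i < d \<Longrightarrow> X ! i \<in> carrier_mat k k" "\<And>i. i < d \<Longrightarrow> herm k (entry (X ! i))"
  shows "X \<in> sa_tuples d k"
proof -
  have "mat_adjoint (X ! i) = X ! i" if "i < d" for i
    using mat_adjoint_herm[OF assms(2,3)[OF that]] .
  then show ?thesis unfolding sa_tuples_def using assms by (auto simp: in_set_conv_nth)
qed

lemma square_sum:
  assumes "X \<in> sa_tuples d k"
  defines "Q \<equiv> mat_sum k (map (\<lambda>x. x * x) X)"
  shows "Q \<in> carrier_mat k k" "herm k (entry Q)"
    "qform k (entry Q) u = (\<Sum>i<d. sqnorm k (mat_apply k (entry (X ! i)) u))"
proof -
  have c: "\<forall>x\<in>set X. x \<in> carrier_mat k k" using assms(1) by (auto simp: sa_tuples_def)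
  have h: "\<forall>x\<in>set X. herm k (entry x)" using herm_nth[OF assms(1)] sa_tuplesD(1)[OF assms(1)]
    by (auto simp: in_set_conv_nth)
  show "Q \<in> carrier_mat k k" unfolding Q_def using c by (intro mat_sum_carrier) auto
  show "herm k (entry Q)" unfolding Q_def using c h by (intro mat_sum_form(2)) (auto intro: qform_square(2))
  have "qform k (entry Q) u = (\<Sum>x\<leftarrow>X. qform k (entry (x * x)) u)"
    unfolding Q_def using c by (subst mat_sum_form(1)) (auto simp: comp_def)
  also have "\<dots> = (\<Sum>x\<leftarrow>X. sqnorm k (mat_apply k (entry x) u))"
    using c h qform_square(1) by (intro arg_cong[of _ _ sum_list] map_cong refl) auto
  also have "\<dots> = (\<Sum>i<d. sqnorm k (mat_apply k (entry (X ! i)) u))"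
    using sa_tuplesD(1)[OF assms(1)] by (simp add: sum_list_sum_nth atLeast0LessThan)
  finally show "qform k (entry Q) u = (\<Sum>i<d. sqnorm k (mat_apply k (entry (X ! i)) u))" .
qed

lemma tuple_norm_eq:
  assumes "1 \<le> d" "X \<in> sa_tuples d k"
  shows "tuple_norm X = sqrt (op_norm (mat_sum k (map (\<lambda>x. x * x) X)))"
proof -
  have "map (\<lambda>x. x * mat_adjoint x) X = map (\<lambda>x. x * x) X"
    using assms(2) by (auto simp: sa_tuples_def)
  then show ?thesis unfolding tuple_norm_def sa_tuples_level[OF assms] by (simp only:)
qed

text \<open>Each \<open>|X\<^sub>iu|\<^sup>2\<close> is one of the nonnegative summands of the form of
  \<open>\<Sum>i. X\<^sub>i\<^sup>2\<close>.\<close>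

lemma component_bound:
  assumes X: "X \<in> sa_tuples d k" and "i < d" "0 \<le> R"
    and b: "\<And>u. qform k (entry (mat_sum k (map (\<lambda>x. x * x) X))) u \<le> R\<^sup>2 * sqnorm k u"
  shows "\<bar>qform k (entry (X ! i)) u\<bar> \<le> R * sqnorm k u"
proof -
  have "sqnorm k (mat_apply k (entry (X ! i)) u) \<le> (\<Sum>i<d. sqnorm k (mat_apply k (entry (X ! i)) u))"
    using assms(2) by (intro member_le_sum[of i "{..<d}" "\<lambda>i. sqnorm k (mat_apply k (entry (X ! i)) u)"]) auto
  then have "sqnorm k (mat_apply k (entry (X ! i)) u) \<le> R\<^sup>2 * sqnorm k u"
    using b[of u] square_sum(3)[OF X] by simp
  then show ?thesis unfolding qform_def sesq_mat_apply using inner_bound assms(3) by blast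
qed

lemma tuple_norm_component_bound:
  assumes "1 \<le> d" "X \<in> sa_tuples d k" "i < d" "tuple_norm X \<le> R"
  shows "\<bar>qform k (entry (X ! i)) u\<bar> \<le> R * sqnorm k u"
proof (rule component_bound[OF assms(2,3)])
  let ?Q = "mat_sum k (map (\<lambda>x. x * x) X)"
  note Q = square_sum(1,2)[OF assms(2)]
  have n: "sqrt (op_norm ?Q) \<le> R" using assms(4) tuple_norm_eq[OF assms(1,2)] by simp
  moreover have "0 \<le> sqrt (op_norm ?Q)" using op_norm_mat_apply(1)[OF Q] by simp
  ultimately show R: "0 \<le> R" by linarith
  have op: "op_norm ?Q \<le> R\<^sup>2" using n by (rule sqrt_le_D)
  show "qform k (entry ?Q) u \<le> R\<^sup>2 * sqnorm k u" for u
    using op_norm_ge[OF Q, of u] mult_right_mono[OF op, of "sqnorm k u"] by simp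
qed

text \<open>The factor \<open>d\<close> is not sharp (its square root would do), but it may enter the
  constants.\<close>

lemma tuple_norm_le:
  assumes "1 \<le> d" "X \<in> sa_tuples d k" "0 \<le> \<gamma>"
    and b: "\<And>i u. i < d \<Longrightarrow> \<bar>qform k (entry (X ! i)) u\<bar> \<le> \<gamma> * sqnorm k u"
  shows "tuple_norm X \<le> real d * \<gamma>"
proof -
  let ?Q = "mat_sum k (map (\<lambda>x. x * x) X)"
  note Q = square_sum[OF assms(2)]
  have "op_norm ?Q \<le> real d * \<gamma>\<^sup>2"
  proof (rule op_norm_le[OF Q(1,2)])
    fix u
    have "(\<Sum>i<d. sqnorm k (mat_apply k (entry (X ! i)) u)) \<le> (\<Sum>i<d. \<gamma>\<^sup>2 * sqnorm k u)"
      using mat_apply_bound[OF herm_nth[OF assms(2)] b assms(3)] by (intro sum_mono) auto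
    then show "\<bar>qform k (entry ?Q) u\<bar> \<le> real d * \<gamma>\<^sup>2 * sqnorm k u"
      unfolding Q(3) by (simp add: sum_nonneg abs_of_nonneg)
  qed simp
  also have "\<dots> \<le> real d * real d * \<gamma>\<^sup>2"
    using assms(1) by (intro mult_right_mono) auto
  also have "\<dots> = (real d * \<gamma>)\<^sup>2" by (simp add: power2_eq_square)
  finally show ?thesis unfolding tuple_norm_eq[OF assms(1,2)] using assms(3)
    by (intro real_le_lsqrt op_norm_mat_apply(1)[OF Q(1,2)]) auto
qed

section \<open>Evaluation of affine polynomials\<close>

text \<open>Read the vector \<open>v\<close> of length \<open>n * k\<close> as the matrix whose column
  \<open>a\<close> is the block with number \<open>a\<close>.\<close>

lemma kron_form:
  assumes "B \<in> carrier_mat n n" "X \<in> carrier_mat k k"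
  shows "kron B X \<in> carrier_mat (n * k) (n * k)"
    and "qform (n * k) (entry (kron B X)) v
      = pairing n (entry B) (compress k (entry X) (\<lambda>a i. v (a * k + i)))"
    and "herm n (entry B) \<Longrightarrow> herm k (entry X) \<Longrightarrow> herm (n * k) (entry (kron B X))"
proof -
  show "kron B X \<in> carrier_mat (n * k) (n * k)" using assms by (simp add: kron_def)
  have e: "entry (kron B X) (a * k + i) (c * k + j) = entry B a c * entry X i j"
    if "a < n" "c < n" "i < k" "j < k" for a c i j
    using assms that mult_add_less by (simp add: kron_def entry_def)
  have "sesq (n * k) (entry (kron B X)) v v = (\<Sum>a<n. \<Sum>c<n. entry B a c *
      sesq k (entry X) (\<lambda>i. v (a * k + i)) (\<lambda>i. v (c * k + i)))"
    unfolding sesq_mult_index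
  proof (intro sum.cong refl)
    fix a c assume ac: "a \<in> {..<n}" "c \<in> {..<n}"
    show "sesq k (\<lambda>i j. entry (kron B X) (a * k + i) (c * k + j)) (\<lambda>i. v (a * k + i)) (\<lambda>j. v (c * k + j))
      = entry B a c * sesq k (entry X) (\<lambda>i. v (a * k + i)) (\<lambda>i. v (c * k + i))"
      unfolding sesq_scale_mat[symmetric] using e ac by (intro sesq_cong) auto
  qed
  then show "qform (n * k) (entry (kron B X)) v
      = pairing n (entry B) (compress k (entry X) (\<lambda>a i. v (a * k + i)))"
    by (simp only: qform_def pairing_def compress_def)
  assume h: "herm n (entry B)" "herm k (entry X)"
  show "herm (n * k) (entry (kron B X))" unfolding herm_def
  proof (intro allI impI)
    fix p q assume pq: "p < n * k" "q < n * k"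
    then have "0 < k" by (cases k) auto
    then have d: "p div k < n" "q div k < n" "p mod k < k" "q mod k < k"
      using pq by (auto simp: less_mult_imp_div_less)
    have "entry B (q div k) (p div k) = cnj (entry B (p div k) (q div k))"
      "entry X (q mod k) (p mod k) = cnj (entry X (p mod k) (q mod k))"
      using hermD[OF h(1) d(1,2)] hermD[OF h(2) d(3,4)] .
    then show "entry (kron B X) q p = cnj (entry (kron B X) p q)"
      using pq assms by (simp add: kron_def entry_def)
  qed
qed

lemma poly_eval_form:
  assumes "1 \<le> d" "X \<in> sa_tuples d k" and B: "\<And>j. j \<le> d \<Longrightarrow> herm n (B j)"
  defines "p \<equiv> (mat n n (\<lambda>(a, c). B 0 a c), map (\<lambda>i. mat n n (\<lambda>(a, c). B (Suc i) a c)) [0..<d])"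
  shows "poly_eval p X \<in> carrier_mat (n * k) (n * k)" "herm (n * k) (entry (poly_eval p X))"
    "qform (n * k) (entry (poly_eval p X)) v
      = (\<Sum>j\<le>d. pairing n (B j) (compress k (coord X j) (\<lambda>a i. v (a * k + i))))"
proof -
  let ?V = "\<lambda>a i. v (a * k + i)"
  let ?b = "\<lambda>j. mat n n (\<lambda>(a, c). B j a c)"
  let ?L = "map2 kron (snd p) X"
  have eb: "entry (?b j) a c = B j a c" if "a < n" "c < n" for j a c using that by (simp add: entry_def)
  have hb: "herm n (entry (?b j))" if "j \<le> d" for j using herm_cong[of n "entry (?b j)" "B j"] eb B[OF that] by auto
  have len: "length X = d" using sa_tuplesD(1)[OF assms(2)] .
  have L: "length ?L = d" "\<And>i. i < d \<Longrightarrow> ?L ! i = kron (?b (Suc i)) (X ! i)" using len by (auto simp: p_def)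
  have Xc: "X ! i \<in> carrier_mat k k" if "i < d" for i using sa_tuplesD(2)[OF assms(2) that] .
  have Lc: "\<forall>A\<in>set ?L. A \<in> carrier_mat (n * k) (n * k)"
  proof
    fix A assume "A \<in> set ?L"
    then obtain i where i: "i < d" "A = kron (?b (Suc i)) (X ! i)" using L by (metis in_set_conv_nth)
    then show "A \<in> carrier_mat (n * k) (n * k)" using kron_form(1)[OF _ Xc] by simp
  qed
  have Lh: "\<forall>A\<in>set ?L. herm (n * k) (entry A)"
  proof
    fix A assume "A \<in> set ?L"
    then obtain i where i: "i < d" "A = kron (?b (Suc i)) (X ! i)" using L by (metis in_set_conv_nth)
    then show "herm (n * k) (entry A)"
      using kron_form(3)[OF _ Xc hb herm_nth[OF assms(2)]] by simp
  qed
  have ev: "poly_eval p X = kron (?b 0) (1\<^sub>m k) + mat_sum (n * k) ?L"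
    by (simp add: poly_eval_def sa_tuples_level[OF assms(1,2)] p_def)
  note C1 = mat_sum_carrier[OF Lc]
  have C0: "kron (?b 0) (1\<^sub>m k) \<in> carrier_mat (n * k) (n * k)" by (intro kron_form(1)) auto
  show "poly_eval p X \<in> carrier_mat (n * k) (n * k)" unfolding ev using C0 C1 by auto
  have e: "entry (poly_eval p X) i j = entry (kron (?b 0) (1\<^sub>m k)) i j + entry (mat_sum (n * k) ?L) i j"
    if "i < n * k" "j < n * k" for i j
    using that C0 C1 unfolding ev entry_def by auto
  have e1: "entry (1\<^sub>m k) i j = unitf i j" if "i < k" "j < k" for i j using that by (simp add: entry_def unitf_def)
  have h1: "herm k (entry (1\<^sub>m k))" using herm_cong[of k "entry (1\<^sub>m k)" unitf] e1 by auto
  have "herm (n * k) (\<lambda>i j. entry (kron (?b 0) (1\<^sub>m k)) i j + entry (mat_sum (n * k) ?L) i j)"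
    using kron_form(3)[OF _ _ hb h1] mat_sum_form(2)[OF Lc Lh] by (intro herm_add) auto
  then show "herm (n * k) (entry (poly_eval p X))"
    by (rule iffD2[OF herm_cong, rotated]) (rule e)
  have "qform (n * k) (entry (poly_eval p X)) v
      = qform (n * k) (\<lambda>i j. entry (kron (?b 0) (1\<^sub>m k)) i j + entry (mat_sum (n * k) ?L) i j) v"
    using e by (intro qform_cong) auto
  also have "\<dots> = qform (n * k) (entry (kron (?b 0) (1\<^sub>m k))) v + (\<Sum>A\<leftarrow>?L. qform (n * k) (entry A) v)"
    using mat_sum_form(1)[OF Lc] by simp
  also have "(\<Sum>A\<leftarrow>?L. qform (n * k) (entry A) v) = (\<Sum>i<d. qform (n * k) (entry (?L ! i)) v)"
    using L(1) by (simp add: sum_list_sum_nth atLeast0LessThan)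
  also have "\<dots> = (\<Sum>i<d. pairing n (B (Suc i)) (compress k (coord X (Suc i)) ?V))"
  proof (intro sum.cong refl)
    fix i assume "i \<in> {..<d}"
    then have i: "i < d" by simp
    have "qform (n * k) (entry (?L ! i)) v = pairing n (entry (?b (Suc i))) (compress k (entry (X ! i)) ?V)"
      unfolding L(2)[OF i] by (rule kron_form(2)) (use Xc i in auto)
    also have "\<dots> = pairing n (B (Suc i)) (compress k (coord X (Suc i)) ?V)"
      using eb by (intro pairing_cong) (auto simp: coord_def)
    finally show "qform (n * k) (entry (?L ! i)) v = pairing n (B (Suc i)) (compress k (coord X (Suc i)) ?V)" .
  qed
  also have "qform (n * k) (entry (kron (?b 0) (1\<^sub>m k))) v = pairing n (entry (?b 0)) (compress k (entry (1\<^sub>m k)) ?V)"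
    by (rule kron_form(2)) auto
  also have "\<dots> = pairing n (B 0) (compress k (coord X 0) ?V)"
    using eb e1 by (intro pairing_cong) (auto simp: coord_def compress_def intro!: sesq_cong)
  also have "pairing n (B 0) (compress k (coord X 0) ?V)
      + (\<Sum>i<d. pairing n (B (Suc i)) (compress k (coord X (Suc i)) ?V))
      = (\<Sum>j\<le>d. pairing n (B j) (compress k (coord X j) ?V))"
    by (simp add: lessThan_Suc_atMost[symmetric] sum.lessThan_Suc_shift del: sum.lessThan_Suc)
  finally show "qform (n * k) (entry (poly_eval p X)) v
      = (\<Sum>j\<le>d. pairing n (B j) (compress k (coord X j) ?V))" .
qed

lemma pairing_compress_bound:
  assumes "pos_semidef n (\<lambda>a c. unitf a c + b a c)" "pos_semidef n (\<lambda>a c. unitf a c - b a c)"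
    and "herm k X" "\<And>u. \<bar>qform k X u\<bar> \<le> r * sqnorm k u"
  shows "\<bar>pairing n b (compress k X V)\<bar> \<le> r * (\<Sum>a<n. sqnorm k (V a))"
proof -
  have "0 \<le> r * sqnorm k u + qform k X u" "0 \<le> r * sqnorm k u - qform k X u" for u
    using assms(4)[of u] by linarith+
  then have "pos_semidef k (\<lambda>i j. of_real r * unitf i j + X i j)" "pos_semidef k (\<lambda>i j. of_real r * unitf i j - X i j)"
    unfolding pos_semidef_def using assms(3) by (simp_all add: herm_add herm_diff herm_scale)
  from this[THEN pos_semidef_compress[of k _ n V]]
  have "pos_semidef n (\<lambda>a c. of_real r * compress k unitf V a c + compress k X V a c)"
    "pos_semidef n (\<lambda>a c. of_real r * compress k unitf V a c - compress k X V a c)"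
    by (simp_all add: compress_def[abs_def] sesq_add_mat sesq_diff_mat sesq_scale_mat)
  from pairing_abs_bound[OF assms(1,2) this]
  have "\<bar>pairing n b (compress k X V)\<bar> \<le> r * pairing n unitf (compress k unitf V)" .
  then show ?thesis
    unfolding pairing_commute[of n unitf] pairing_unit by (simp add: compress_def qform_def[symmetric])
qed

lemma sqnorm_mult_index: "sqnorm (n * k) v = (\<Sum>a<n. sqnorm k (\<lambda>i. v (a * k + i)))"
  unfolding sqnorm_def sum_lessThan_mult ..

text \<open>The polynomial is \<open>s (M - b\<^sub>0 - \<Sum>i. b\<^sub>i z\<^sub>i)\<close>.  Its norm
  is at most 1 since each of the \<open>d + 1\<close> terms with coefficient \<open>b\<^sub>j\<close> is
  at most 1 on the unit ball.\<close>

lemma scaled_polynomial: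
  assumes "1 \<le> d" "0 \<le> M"
    and b: "\<And>j. j \<le> d \<Longrightarrow> pos_semidef n (\<lambda>a c. unitf a c + b j a c)" "\<And>j. j \<le> d \<Longrightarrow> pos_semidef n (\<lambda>a c. unitf a c - b j a c)"
  defines "s \<equiv> 1 / (M + real d + 1)"
  obtains p where "p \<in> affine_polys d n" "poly_norm p \<le> 1"
    "\<And>k X. X \<in> sa_tuples d k \<Longrightarrow> poly_eval p X \<in> carrier_mat (n * k) (n * k)"
    "\<And>k X. X \<in> sa_tuples d k \<Longrightarrow> herm (n * k) (entry (poly_eval p X))"
    "\<And>k X v. X \<in> sa_tuples d k \<Longrightarrow> qform (n * k) (entry (poly_eval p X)) v = s * (M * sqnorm (n * k) v
       - (\<Sum>j\<le>d. pairing n (b j) (compress k (coord X j) (\<lambda>a i. v (a * k + i)))))"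
proof -
  have s: "0 < s" "s * (M + real d + 1) = 1" using assms(2) by (auto simp: s_def)
  define B where "B = (\<lambda>j a c. of_real s * (of_real (if j = 0 then M else 0) * unitf a c - b j a c))"
  define p where "p = (mat n n (\<lambda>(a, c). B 0 a c), map (\<lambda>i. mat n n (\<lambda>(a, c). B (Suc i) a c)) [0..<d])"
  have herm_b: "herm n (b j)" if "j \<le> d" for j
  proof -
    have "herm n (\<lambda>a c. (unitf a c + b j a c) - unitf a c)"
      using b(1)[OF that] by (intro herm_diff) (auto simp: pos_semidef_def)
    then show ?thesis by simp
  qed
  have hB: "herm n (B j)" if "j \<le> d" for j
    unfolding B_def using herm_b[OF that] by (intro herm_scale herm_diff herm_unit)
  have form: "qform (n * k) (entry (poly_eval p X)) v = s * (M * sqnorm (n * k) v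
       - (\<Sum>j\<le>d. pairing n (b j) (compress k (coord X j) (\<lambda>a i. v (a * k + i)))))"
    if X: "X \<in> sa_tuples d k" for k X v
  proof -
    let ?V = "\<lambda>a i. v (a * k + i)"
    have "qform (n * k) (entry (poly_eval p X)) v = (\<Sum>j\<le>d. pairing n (B j) (compress k (coord X j) ?V))"
      unfolding p_def by (rule poly_eval_form(3)[OF assms(1) X hB])
    also have "\<dots> = (\<Sum>j\<le>d. s * ((if j = 0 then M * pairing n unitf (compress k (coord X 0) ?V) else 0)
        - pairing n (b j) (compress k (coord X j) ?V)))"
      unfolding B_def pairing_scale_left pairing_diff_left by (intro sum.cong refl) auto
    also have "\<dots> = s * (M * pairing n unitf (compress k (coord X 0) ?V)
        - (\<Sum>j\<le>d. pairing n (b j) (compress k (coord X j) ?V)))"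
      by (simp add: sum_distrib_left[symmetric] sum_subtractf)
    also have "pairing n unitf (compress k (coord X 0) ?V) = sqnorm (n * k) v"
      unfolding pairing_commute[of n unitf] pairing_unit sqnorm_mult_index
      by (simp add: compress_def qform_def[symmetric] coord_def)
    finally show ?thesis .
  qed
  show thesis
  proof (rule that[of p])
    show "p \<in> affine_polys d n" by (auto simp: p_def affine_polys_def)
    show c: "poly_eval p X \<in> carrier_mat (n * k) (n * k)" if "X \<in> sa_tuples d k" for k X
      unfolding p_def by (rule poly_eval_form(1)[OF assms(1) that hB])
    show h: "herm (n * k) (entry (poly_eval p X))" if "X \<in> sa_tuples d k" for k X
      unfolding p_def by (rule poly_eval_form(2)[OF assms(1) that hB])
    show "qform (n * k) (entry (poly_eval p X)) v = s * (M * sqnorm (n * k) v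
       - (\<Sum>j\<le>d. pairing n (b j) (compress k (coord X j) (\<lambda>a i. v (a * k + i)))))"
      if "X \<in> sa_tuples d k" for k X v using form[OF that] .
    show "poly_norm p \<le> 1" unfolding poly_norm_def
    proof (rule SUP_least)
      fix X assume "X \<in> {X \<in> all_sa_tuples (length (snd p)). tuple_norm X \<le> 1}"
      then obtain k where X: "X \<in> sa_tuples d k" "tuple_norm X \<le> 1"
        by (auto simp: all_sa_tuples_def p_def)
      have "op_norm (poly_eval p X) \<le> 1"
      proof (rule op_norm_le[OF c[OF X(1)] h[OF X(1)]])
        fix v :: "nat \<Rightarrow> complex"
        let ?V = "\<lambda>a i. v (a * k + i)"
        have "\<bar>pairing n (b j) (compress k (coord X j) ?V)\<bar> \<le> 1 * (\<Sum>a<n. sqnorm k (?V a))" if j: "j \<le> d" for j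
        proof (rule pairing_compress_bound[OF b(1)[OF j] b(2)[OF j] herm_coord[OF X(1) j]])
          show "\<bar>qform k (coord X j) u\<bar> \<le> 1 * sqnorm k u" for u
            using tuple_norm_component_bound[OF assms(1) X(1) _ X(2)] j
            by (cases j) (auto simp: coord_def)
        qed
        then have "(\<Sum>j\<le>d. \<bar>pairing n (b j) (compress k (coord X j) ?V)\<bar>) \<le> (\<Sum>j\<le>d. sqnorm (n * k) v)"
          unfolding sqnorm_mult_index by (intro sum_mono) auto
        then have "(\<Sum>j\<le>d. \<bar>pairing n (b j) (compress k (coord X j) ?V)\<bar>) \<le> (real d + 1) * sqnorm (n * k) v"
          by (simp add: algebra_simps)
        then have "\<bar>\<Sum>j\<le>d. pairing n (b j) (compress k (coord X j) ?V)\<bar> \<le> (real d + 1) * sqnorm (n * k) v"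
          by (rule order.trans[OF sum_abs])
        then have "\<bar>M * sqnorm (n * k) v - (\<Sum>j\<le>d. pairing n (b j) (compress k (coord X j) ?V))\<bar>
            \<le> M * sqnorm (n * k) v + (real d + 1) * sqnorm (n * k) v"
          using mult_nonneg_nonneg[OF assms(2) sqnorm_nonneg[of "n * k" v]] by linarith
        also have "\<dots> = (M + real d + 1) * sqnorm (n * k) v" by (simp add: algebra_simps)
        finally have "\<bar>qform (n * k) (entry (poly_eval p X)) v\<bar> \<le> s * ((M + real d + 1) * sqnorm (n * k) v)"
          unfolding form[OF X(1)] using s(1) by (simp add: abs_mult mult_left_mono)
        then show "\<bar>qform (n * k) (entry (poly_eval p X)) v\<bar> \<le> 1 * sqnorm (n * k) v"
          using s(2) by (simp add: mult.assoc[symmetric])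
      qed simp
      then show "ereal (op_norm (poly_eval p X)) \<le> 1" by (simp add: one_ereal_def)
    qed
  qed
qed

section \<open>The uniform gap\<close>

text \<open>The bound \<open>R\<close> is taken at least 1 so that it also covers the identity component.
  Strictness of the inequality costs half of the available gap \<open>s e\<close>.\<close>

lemma uniform_separation:
  assumes "1 \<le> d" "1 \<le> R" "0 < \<epsilon>"
  shows "\<exists>\<delta>>0. \<forall>S. matrix_convex d S \<longrightarrow> level_bounded d R S \<longrightarrow>
     (\<forall>n\<ge>1. \<forall>A \<in> sa_tuples d n. tuple_dist A S > ereal \<epsilon> \<longrightarrow>
        (\<exists>p \<in> affine_polys d n. poly_norm p \<le> 1 \<and>
           (\<forall>X \<in> S. op_norm (poly_eval p A) > op_norm (poly_eval p X) + \<delta>)))"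
proof -
  define e where "e = \<epsilon> / (real d * (2 + 6 * R))"
  define M where "M = (real d + 1) * R"
  define s where "s = 1 / (M + real d + 1)"
  have dR: "0 < real d * (2 + 6 * R)" using assms by (intro mult_pos_pos) auto
  have e: "0 < e" "real d * ((2 + 6 * R) * e) = \<epsilon>"
    using assms dR by (auto simp: e_def mult.assoc[symmetric])
  have M: "0 \<le> M" using assms by (simp add: M_def)
  have s: "0 < s" using M by (simp add: s_def)
  show ?thesis
  proof (intro exI[of _ "s * e / 2"] conjI allI impI ballI)
    show "0 < s * e / 2" using s e by simp
    fix S n A
    assume S: "matrix_convex d S" "level_bounded d R S" and n: "1 \<le> n" and A: "A \<in> sa_tuples d n"
      and dist: "ereal \<epsilon> < tuple_dist A S"
    show "\<exists>p \<in> affine_polys d n. poly_norm p \<le> 1 \<and>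
        (\<forall>X \<in> S. op_norm (poly_eval p A) > op_norm (poly_eval p X) + s * e / 2)"
    proof (cases "S = {}")
      case True
      obtain p where "p \<in> affine_polys d n" "poly_norm p \<le> 1"
        by (rule scaled_polynomial[OF assms(1) M, where n = n and b = "\<lambda>j a c. 0"])
          (simp | rule that; assumption)+
      then show ?thesis using True by blast
    next
      case False
      have far: "\<exists>j\<le>d. \<exists>u. 2 * e * sqnorm n u < \<bar>qform n (coord A j) u - qform n (g j) u\<bar>"
        if g: "g \<in> compression_cone d n S" for g
      proof (rule ccontr)
        assume "\<not> ?thesis"
        then have close: "\<And>j u. j \<le> d \<Longrightarrow> \<bar>qform n (coord A j) u - qform n (g j) u\<bar> \<le> 2 * e * sqnorm n u"
          by (meson not_less)
        obtain Z where Z: "Z \<in> S" "Z \<in> sa_tuples d n"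
          "\<And>j u. j \<le> d \<Longrightarrow> \<bar>qform n (coord A j) u - qform n (coord Z j) u\<bar> \<le> (2 + 6 * R) * e * sqnorm n u"
          using compression_cone_near_gives_near_element[OF assms(1) n S(1) False S(2) assms(2) e(1) g close] by blast
        let ?D = "map2 (-) A Z"
        have lens: "length A = d" "length Z = d" using sa_tuplesD(1) A Z(2) by blast+
        have nth: "?D ! i = A ! i - Z ! i" if "i < d" for i using that lens by simp
        have cA: "A ! i \<in> carrier_mat n n" "Z ! i \<in> carrier_mat n n" if "i < d" for i
          using sa_tuplesD(2)[OF A that] sa_tuplesD(2)[OF Z(2) that] .
        have entry_D: "entry (?D ! i) a c = entry (A ! i) a c - entry (Z ! i) a c" if "i < d" "a < n" "c < n" for i a c
          using cA[OF that(1)] that(2,3) unfolding nth[OF that(1)] entry_def by auto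
        have D: "?D \<in> sa_tuples d n"
        proof (rule sa_tuplesI)
          fix i assume i: "i < d"
          show "?D ! i \<in> carrier_mat n n" unfolding nth[OF i] by (rule minus_carrier_mat[OF cA(2)[OF i]])
          have "herm n (\<lambda>a c. entry (A ! i) a c - entry (Z ! i) a c)"
            using herm_nth[OF A i] herm_nth[OF Z(2) i] by (rule herm_diff)
          then show "herm n (entry (?D ! i))"
            by (rule iffD2[OF herm_cong, rotated]) (rule entry_D[OF i])
        qed (use lens in simp)
        have "tuple_norm ?D \<le> real d * ((2 + 6 * R) * e)"
        proof (rule tuple_norm_le[OF assms(1) D])
          show "0 \<le> (2 + 6 * R) * e" using assms(2) e by simp
          fix i u assume i: "i < d"
          have "qform n (entry (?D ! i)) u = qform n (\<lambda>a c. entry (A ! i) a c - entry (Z ! i) a c) u"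
            using entry_D[OF i] by (intro qform_cong) auto
          then show "\<bar>qform n (entry (?D ! i)) u\<bar> \<le> (2 + 6 * R) * e * sqnorm n u"
            using Z(3)[of "Suc i" u] i by (simp add: coord_def)
        qed
        then have "tuple_norm ?D \<le> \<epsilon>" using e(2) by simp
        moreover have "tuple_dist A S \<le> ereal (tuple_norm ?D)"
          unfolding tuple_dist_def sa_tuples_level[OF assms(1) A] lens using Z by (intro INF_lower) auto
        ultimately show False using dist by (meson ereal_less_eq(3) le_less_trans not_less order_refl order.trans)
      qed
      obtain b V where b: "\<And>j. j \<le> d \<Longrightarrow> pos_semidef n (\<lambda>a c. unitf a c + b j a c)"
          "\<And>j. j \<le> d \<Longrightarrow> pos_semidef n (\<lambda>a c. unitf a c - b j a c)"
        and nonneg: "\<And>k X V. X \<in> S \<Longrightarrow> X \<in> sa_tuples d k \<Longrightarrow> 1 \<le> k \<Longrightarrow>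
            0 \<le> (\<Sum>j\<le>d. pairing n (b j) (compress k (coord X j) V))"
        and neg: "(\<Sum>j\<le>d. pairing n (b j) (compress n (coord A j) V)) \<le> - e * (\<Sum>a<n. sqnorm n (V a))"
        and V: "0 < (\<Sum>a<n. sqnorm n (V a))"
        by (rule normalised_separating_functional[OF assms(1) n S(1) False S(2) assms(2) e(1) A far])
          (assumption | rule that; assumption)+
      obtain p where p: "p \<in> affine_polys d n" "poly_norm p \<le> 1"
        "\<And>k X. X \<in> sa_tuples d k \<Longrightarrow> poly_eval p X \<in> carrier_mat (n * k) (n * k)"
        "\<And>k X. X \<in> sa_tuples d k \<Longrightarrow> herm (n * k) (entry (poly_eval p X))"
        and form: "\<And>k X v. X \<in> sa_tuples d k \<Longrightarrow> qform (n * k) (entry (poly_eval p X)) v = s * (M * sqnorm (n * k) v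
           - (\<Sum>j\<le>d. pairing n (b j) (compress k (coord X j) (\<lambda>a i. v (a * k + i)))))"
        by (rule scaled_polynomial[OF assms(1) M b, folded s_def]) (assumption | rule that; assumption)+
      have "s * (M + e) \<le> op_norm (poly_eval p A)"
      proof -
        define v where "v = (\<lambda>i. V (i div n) (i mod n))"
        have v: "v (a * n + i) = V a i" if "i < n" for a i using that by (simp add: v_def)
        have sv: "sqnorm (n * n) v = (\<Sum>a<n. sqnorm n (V a))"
          unfolding sqnorm_mult_index by (simp add: sqnorm_def v)
        have "pairing n (b j) (compress n (coord A j) (\<lambda>a i. v (a * n + i))) = pairing n (b j) (compress n (coord A j) V)" for j
          unfolding compress_def using v by (intro pairing_cong sesq_cong) auto
        then have "M * sqnorm (n * n) v + e * sqnorm (n * n) v \<le> M * sqnorm (n * n) v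
           - (\<Sum>j\<le>d. pairing n (b j) (compress n (coord A j) (\<lambda>a i. v (a * n + i))))"
          using neg sv by simp
        then have "s * (M * sqnorm (n * n) v + e * sqnorm (n * n) v) \<le> qform (n * n) (entry (poly_eval p A)) v"
          unfolding form[OF A] using s by (intro mult_left_mono) auto
        also have "\<dots> \<le> op_norm (poly_eval p A) * sqnorm (n * n) v"
          using op_norm_ge[OF p(3)[OF A] p(4)[OF A], of v] by linarith
        finally have "s * (M + e) * sqnorm (n * n) v \<le> op_norm (poly_eval p A) * sqnorm (n * n) v"
          by (simp add: algebra_simps)
        then show ?thesis using V sv by (simp only: mult_le_cancel_right_pos)
      qed
      moreover have "op_norm (poly_eval p X) \<le> s * M" if "X \<in> S" for X
      proof -
        have "X \<in> all_sa_tuples d" using S(1) that unfolding matrix_convex_def by blast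
        then obtain k where X: "1 \<le> k" "X \<in> sa_tuples d k" by (auto simp: all_sa_tuples_def)
        show ?thesis
        proof (rule op_norm_le[OF p(3)[OF X(2)] p(4)[OF X(2)]])
          fix v :: "nat \<Rightarrow> complex"
          let ?V = "\<lambda>a i. v (a * k + i)"
          let ?T = "\<Sum>j\<le>d. pairing n (b j) (compress k (coord X j) ?V)"
          have "?T \<le> (\<Sum>j\<le>d. R * sqnorm (n * k) v)"
          proof (rule sum_mono)
            fix j assume "j \<in> {..d}"
            then have j: "j \<le> d" by simp
            have "\<bar>pairing n (b j) (compress k (coord X j) ?V)\<bar> \<le> R * (\<Sum>a<n. sqnorm k (?V a))"
              using S(2) that X j unfolding level_bounded_def
              by (intro pairing_compress_bound[OF b(1)[OF j] b(2)[OF j] herm_coord[OF X(2) j]]) auto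
            then show "pairing n (b j) (compress k (coord X j) ?V) \<le> R * sqnorm (n * k) v"
              by (simp add: sqnorm_mult_index)
          qed
          also have "\<dots> = M * sqnorm (n * k) v" by (simp add: M_def algebra_simps)
          finally have "?T \<le> M * sqnorm (n * k) v" .
          moreover have "0 \<le> ?T" using nonneg[OF that X(2,1)] .
          ultimately have "\<bar>M * sqnorm (n * k) v - ?T\<bar> \<le> M * sqnorm (n * k) v" by linarith
          then show "\<bar>qform (n * k) (entry (poly_eval p X)) v\<bar> \<le> s * M * sqnorm (n * k) v"
            unfolding form[OF X(2)] using s by (simp add: abs_mult mult.assoc mult_left_mono)
        qed (use s M in auto)
      qed
      moreover have "s * M + s * e / 2 < s * (M + e)" using s e by (simp add: algebra_simps)
      ultimately show ?thesis using p(1,2) by (meson add_right_mono le_less_trans less_le_trans)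
    qed
  qed
qed

lemma level_boundedI:
  assumes "\<And>k X i u. X \<in> S \<Longrightarrow> X \<in> sa_tuples d k \<Longrightarrow> i < d \<Longrightarrow> \<bar>qform k (entry (X ! i)) u\<bar> \<le> R * sqnorm k u"
  shows "level_bounded d (max 1 R) S"
  unfolding level_bounded_def
proof (intro allI ballI impI)
  fix k X j u assume X: "X \<in> S \<inter> sa_tuples d k" and j: "j \<le> d"
  have m: "1 * sqnorm k u \<le> max 1 R * sqnorm k u" "R * sqnorm k u \<le> max 1 R * sqnorm k u"
    by (intro mult_right_mono, simp_all)+
  show "\<bar>qform k (coord X j) u\<bar> \<le> max 1 R * sqnorm k u"
  proof (cases j)
    case 0
    then show ?thesis using m(1) by (simp add: coord_def)
  next
    case (Suc i)
    then have "\<bar>qform k (entry (X ! i)) u\<bar> \<le> R * sqnorm k u" using X j assms by auto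
    then show ?thesis using m(2) Suc by (simp add: coord_def)
  qed
qed

lemma level_bounded_of_norm_bound:
  assumes "1 \<le> d" "\<And>X. X \<in> S \<Longrightarrow> tuple_norm X \<le> R"
  shows "level_bounded d (max 1 R) S"
  using tuple_norm_component_bound[OF assms(1) _ _ assms(2)] by (intro level_boundedI) auto

text \<open>Positivity of the form of \<open>1 - \<Sum>i. Y\<^sub>i\<^sup>2\<close> at \<open>u\<close>
  bounds each \<open>|Y\<^sub>iu|\<close> by \<open>|u|\<close>.\<close>

lemma level_bounded_of_ball:
  assumes "1 \<le> d" "0 < R" "S \<subseteq> scale_tuples R (sa_ball d)"
  shows "level_bounded d (max 1 R) S"
proof (rule level_boundedI)
  fix k X i u assume X: "X \<in> S" "X \<in> sa_tuples d k" and i: "i < d"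
  then obtain Y where Y: "Y \<in> sa_ball d" "X = map (\<lambda>x. of_real R \<cdot>\<^sub>m x) Y"
    using assms(3) unfolding scale_tuples_def by auto
  then obtain l where l: "Y \<in> sa_tuples d l" by (auto simp: sa_ball_def all_sa_tuples_def)
  have lenY: "length Y = d" using sa_tuplesD(1)[OF l] .
  have "X ! 0 \<in> carrier_mat l l" using sa_tuplesD(2)[OF l, of 0] lenY assms(1) Y(2) by simp
  moreover have "X ! 0 \<in> carrier_mat k k" using sa_tuplesD(2)[OF X(2), of 0] assms(1) by simp
  ultimately have "l = k" by auto
  then have Yk: "Y \<in> sa_tuples d k" using l by simp
  let ?Q = "mat_sum k (map (\<lambda>x. x * x) Y)"
  note Q = square_sum[OF Yk]
  have "psd k (1\<^sub>m k - ?Q)" using Y(1) sa_tuples_level[OF assms(1) Yk] by (simp add: sa_ball_def)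
  moreover have "1\<^sub>m k - ?Q \<in> carrier_mat k k" using Q(1) by auto
  ultimately have "0 \<le> sesq k (entry (1\<^sub>m k - ?Q)) v v" for v using psd_iff by blast
  then have "0 \<le> qform k (entry (1\<^sub>m k - ?Q)) v" for v by (simp add: qform_def less_eq_complex_def)
  moreover have "qform k (entry (1\<^sub>m k - ?Q)) v = qform k (\<lambda>a c. unitf a c - entry ?Q a c) v" for v
    using Q(1) by (intro qform_cong) (auto simp: entry_def unitf_def)
  ultimately have "qform k (entry ?Q) v \<le> 1\<^sup>2 * sqnorm k v" for v by simp
  then have bY: "\<bar>qform k (entry (Y ! i)) u\<bar> \<le> 1 * sqnorm k u" by (intro component_bound[OF Yk i]) auto
  have "qform k (entry (X ! i)) u = qform k (\<lambda>a c. of_real R * entry (Y ! i) a c) u"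
    using sa_tuplesD(2)[OF Yk i] i lenY by (intro qform_cong) (auto simp: Y(2) entry_def)
  then show "\<bar>qform k (entry (X ! i)) u\<bar> \<le> R * sqnorm k u"
    using bY assms(2) by (simp add: abs_mult mult_left_mono)
qed

theorem lemma2p1:
  fixes d :: nat
  assumes "d \<ge> 1"
  shows "(\<forall>S. matrix_convex d S \<longrightarrow> tuples_bounded S \<longrightarrow>
            (\<forall>\<epsilon>>0. \<exists>\<delta>>0.
              (\<forall>n\<ge>1. \<forall>A \<in> sa_tuples d n. tuple_dist A S > ereal \<epsilon> \<longrightarrow>
                 (\<exists>p \<in> affine_polys d n. poly_norm p \<le> 1 \<and>
                    (\<forall>X \<in> S. op_norm (poly_eval p A) > op_norm (poly_eval p X) + \<delta>))))) \<and>
         (\<forall>R>0. \<forall>\<epsilon>>0. \<exists>\<delta>>0. \<forall>S. matrix_convex d S \<longrightarrow>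
            S \<subseteq> scale_tuples R (sa_ball d) \<longrightarrow>
              (\<forall>n\<ge>1. \<forall>A \<in> sa_tuples d n. tuple_dist A S > ereal \<epsilon> \<longrightarrow>
                 (\<exists>p \<in> affine_polys d n. poly_norm p \<le> 1 \<and>
                    (\<forall>X \<in> S. op_norm (poly_eval p A) > op_norm (poly_eval p X) + \<delta>))))"
proof (intro conjI allI impI)
  fix S and \<epsilon> :: real
  assume S: "matrix_convex d S" "tuples_bounded S" and "0 < \<epsilon>"
  from S(2) obtain R where "\<And>X. X \<in> S \<Longrightarrow> tuple_norm X \<le> R" unfolding tuples_bounded_def by blast
  then have "level_bounded d (max 1 R) S" by (rule level_bounded_of_norm_bound[OF assms])
  then show "\<exists>\<delta>>0. \<forall>n\<ge>1. \<forall>A \<in> sa_tuples d n. tuple_dist A S > ereal \<epsilon> \<longrightarrow>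
     (\<exists>p \<in> affine_polys d n. poly_norm p \<le> 1 \<and>
        (\<forall>X \<in> S. op_norm (poly_eval p A) > op_norm (poly_eval p X) + \<delta>))"
    using uniform_separation[OF assms max.cobounded1 \<open>0 < \<epsilon>\<close>, of R] S(1) by blast
next
  fix R \<epsilon> :: real
  assume "0 < R" "0 < \<epsilon>"
  then show "\<exists>\<delta>>0. \<forall>S. matrix_convex d S \<longrightarrow> S \<subseteq> scale_tuples R (sa_ball d) \<longrightarrow>
     (\<forall>n\<ge>1. \<forall>A \<in> sa_tuples d n. tuple_dist A S > ereal \<epsilon> \<longrightarrow>
        (\<exists>p \<in> affine_polys d n. poly_norm p \<le> 1 \<and>
           (\<forall>X \<in> S. op_norm (poly_eval p A) > op_norm (poly_eval p X) + \<delta>)))"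
    using uniform_separation[OF assms max.cobounded1 \<open>0 < \<epsilon>\<close>, of R] level_bounded_of_ball[OF assms \<open>0 < R\<close>]
    by meson
qed

end
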